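(* There exists an absolute constant $C>0$ such that the following holds. Let $N\ge 10^6$, $M\ge\sqrt N$ and $\ell\ge 2$ be real numbers, and put $R=\sum_{M+1\le p\le M+N}1$. For all complex numbers $(u_p)_{M+1\le p\le M+N}$, indexed by the primes in $[M+1,M+N]$, satisfying $\sum_{M+1\le p\le M+N}|u_p|^2\le R$, we have $$\Bigl(\int_0^1\Bigl|\sum_{M+1\le p\le M+N}u_p e(p\alpha)\Bigr|^{\ell}d\alpha\Bigr)^{1/\ell}\le C\sqrt{\frac{N/\log N}{1+R}}\,\Bigl(\int_0^1\Bigl|\sum_{M+1\le p\le M+N}e(p\alpha)\Bigr|^{\ell}d\alpha\Bigr)^{1/\ell}.$$
   Context: The variable $p$ always denotes a prime number, and sums over $p$ run over primes, so $R$ is the number of primes in $[M+1,M+N]$. We write $e(\alpha)=\exp(2i\pi\alpha)$. *)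

theory Defs
  imports "HOL-Analysis.Analysis" "HOL-Computational_Algebra.Primes"
begin

definition e_char :: "real \<Rightarrow> complex" where
  "e_char \<alpha> = exp (2 * \<i> * of_real pi * of_real \<alpha>)"

(* The endpoints M + 1 and M + N are real and need not be integers. *)
definition primes_between :: "real \<Rightarrow> real \<Rightarrow> nat set" where
  "primes_between a b = {p. prime p \<and> a \<le> real p \<and> real p \<le> b}"

end

theory Submission
  imports Defs "HOL-Number_Theory.Totient" "HOL-Computational_Algebra.Squarefree"
begin

text \<open>
Write \<open>S\<close> for the exponential sum with coefficients \<open>u\<close>, \<open>T\<close> for the one with coefficients 1,
\<open>t = l - 2\<close>, and let \<open>H\<close> be \<open>N\<close> rounded up. The two moments are bounded by explicit
quantities with a common factor. For \<open>2 < l \<le> 4\<close> they are, up to factors \<open>C powr l\<close>,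
  \<open>(1/N) * (N * R / ln N) powr (l/2) * min (ln N) (1/t)\<close>
as an upper bound for the integral of \<open>\<bar>S\<bar> powr l\<close>, and
  \<open>(1/N) * R powr l * min (ln N) (1/t)\<close>
as a lower bound for the integral of \<open>\<bar>T\<bar> powr l\<close>. It is the common factor \<open>min (ln N) (1/t)\<close>
that makes the constant uniform down to \<open>l = 2\<close>; the ratio of the rest is the \<open>l\<close>-th power of
the factor in the theorem.

The lower bound needs only that primes beyond \<open>q\<close> are coprime to \<open>q\<close>. For squarefree \<open>q\<close>
the sum of \<open>T (\<beta> + a/q)\<close> over reduced residues \<open>a\<close> is \<open>T \<beta>\<close> up to sign, because a
Ramanujan sum at a squarefree modulus and coprime argument is 1 or -1
(\<open>sum_exp_sum_totatives\<close>). By convexity the arcs around the \<open>a/q\<close> carry at least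
\<open>\<phi>(q) powr (1 - l)\<close> times the mass of \<open>T\<close> around 0, where \<open>\<bar>T\<bar> \<ge> R/2\<close>. Summation over the
squarefree \<open>q\<close> up to a small power of \<open>N\<close> gives \<open>min (ln N) (1/t)\<close>
(\<open>integral_exp_sum_powr_ge\<close>, \<open>sum_totient_powr_ge\<close>).

The upper bound rests on a large sieve inequality for primes (\<open>prime_large_sieve\<close>): over any \<open>K\<close>
points of a grid of step \<open>1/H\<close>, the sum of \<open>\<bar>S\<bar>\<^sup>2\<close> is at most a constant times
\<open>(N / ln N) * ln (2 K) * (\<Sum>\<bar>u\<bar>\<^sup>2)\<close>. The gain over the classical bound \<open>N * (\<Sum>\<bar>u\<bar>\<^sup>2)\<close> comes from the
same averaging identity: a large value of \<open>S\<close> at \<open>b\<close> forces large values at the points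
\<open>b + a/q\<close>. Such points may coincide for different \<open>b\<close>. Restricting \<open>q\<close> to moduli without prime
factors up to \<open>K\<^sup>2\<close> makes these coincidences negligible, since each of them forces a common large
prime into the denominators (\<open>cell_overlap_offdiag\<close>); the price is that the total weight of the moduli
drops from \<open>ln N\<close> to \<open>ln N / ln K\<close>, by the upper bound in Mertens' product theorem
(\<open>totient_mass_ge\<close>).

To pass from large values to the integral of \<open>\<bar>S\<bar> powr l\<close>, the values of \<open>\<bar>S\<bar>\<close> are grouped into
classes of ratio \<open>2 powr (1/t)\<close>. Binary classes would lose a factor \<open>1/t\<^sup>2\<close>; with these long classes
only \<open>1/t\<close> is lost, which is what the lower bound affords (\<open>sum_powr_le_of_log_large_values\<close>). The
range of bounded \<open>t * ln N\<close> follows from Parseval, and the range \<open>t > 2\<close> from the case \<open>t = 2\<close>, both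
with the trivial bound \<open>\<bar>S\<bar> \<le> R\<close> for the remaining powers.
\<close>

section \<open>Squarefree moduli free of small primes\<close>

definition sieve_moduli :: "nat \<Rightarrow> nat set \<Rightarrow> nat set" where
  "sieve_moduli z A = {q. 0 < q \<and> q \<le> z \<and> squarefree q \<and> (\<forall>p\<in>A. \<not> p dvd q)}"

lemma finite_sieve_moduli [simp]: "finite (sieve_moduli z A)"
  by (rule finite_subset[of _ "{..z}"]) (auto simp: sieve_moduli_def)

lemma sum_inverse_squares_le: "(\<Sum>m=1..n. 1 / (real m)\<^sup>2) \<le> 2"
proof -
  have "(\<Sum>m=1..n. 1 / (real m)\<^sup>2) \<le> 2 - 1 / real n" if "n \<ge> 1"
    using that
  proof (induction n rule: nat_induct_at_least)
    case base
    then show ?case by simp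
  next
    case (Suc n)
    have "1 / (real (Suc n))\<^sup>2 \<le> 1 / (real n * real (Suc n))"
      using Suc by (intro divide_left_mono) (auto simp: power2_eq_square)
    also have "\<dots> = 1 / real n - 1 / real (Suc n)"
      using Suc by (simp add: field_simps)
    finally show ?case using Suc by simp
  qed
  moreover have "1 / real n \<ge> 0" by simp
  ultimately show ?thesis by (cases "n \<ge> 1") (linarith, simp)
qed

text \<open>Every \<open>n \<le> z\<close> is a squarefree number times a square, so the harmonic sum is at most the squarefree
part of it times \<open>\<zeta>(2) \<le> 2\<close>.\<close>

lemma ln_le_sum_inverse_squarefree:
  "ln (real z + 1) \<le> 2 * (\<Sum>q\<in>sieve_moduli z {}. 1 / real q)"
proof -
  let ?Q = "sieve_moduli z {}"
  have "ln (real z + 1) \<le> harm z" by (rule ln_le_harm)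
  also have "harm z = (\<Sum>n\<in>{1..z}. 1 / real n)"
    by (simp add: harm_def inverse_eq_divide)
  also have "\<dots> \<le> (\<Sum>x\<in>?Q \<times> {1..z}. 1 / real (fst x * snd x ^ 2))"
  proof (rule sum_le_included[where i = "\<lambda>x. fst x * snd x ^ 2"])
    show "\<forall>n\<in>{1..z}. \<exists>y\<in>?Q \<times> {1..z}. fst y * (snd y)\<^sup>2 = n \<and> 1 / real n \<le> 1 / real (fst y * (snd y)\<^sup>2)"
    proof
      fix n assume n: "n \<in> {1..z}"
      have e: "squarefree_part n * square_part n ^ 2 = n"
        using squarefree_decompose[of n] by simp
      have pos: "squarefree_part n > 0" "square_part n > 0"
        using n e by (auto intro!: Nat.gr0I)
      have "squarefree_part n \<le> n" "square_part n \<le> n"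
      proof -
        have "squarefree_part n dvd n" "square_part n dvd n"
          by (metis e dvd_triv_left, metis e dvd_mult dvd_triv_left power2_eq_square)
        then show "squarefree_part n \<le> n" "square_part n \<le> n"
          using n by (auto intro: dvd_imp_le)
      qed
      moreover have "squarefree (squarefree_part n)" using n by (simp)
      ultimately have "(squarefree_part n, square_part n) \<in> ?Q \<times> {1..z}"
        using pos n by (auto simp: sieve_moduli_def)
      then show "\<exists>y\<in>?Q \<times> {1..z}. fst y * (snd y)\<^sup>2 = n \<and> 1 / real n \<le> 1 / real (fst y * (snd y)\<^sup>2)"
        by (rule rev_bexI) (simp add: e)
    qed
  qed auto
  also have "\<dots> = (\<Sum>q\<in>?Q. 1 / real q) * (\<Sum>m=1..z. 1 / (real m)\<^sup>2)"
    by (simp add: sum_product sum.cartesian_product case_prod_unfold)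
  also have "\<dots> \<le> (\<Sum>q\<in>?Q. 1 / real q) * 2"
    by (intro mult_left_mono sum_inverse_squares_le sum_nonneg) auto
  finally show ?thesis by simp
qed

text \<open>A squarefree modulus divisible by \<open>p\<close> is \<open>p\<close> times a smaller modulus that is not.\<close>

lemma sum_sieve_moduli_insert_le:
  fixes p :: nat
  assumes p: "prime p" and A: "\<forall>r\<in>A. prime r" "p \<notin> A"
  shows "(\<Sum>q\<in>sieve_moduli z A. 1 / real q)
         \<le> (1 + 1 / real p) * (\<Sum>q\<in>sieve_moduli z (insert p A). 1 / real q)"
proof -
  let ?Q = "sieve_moduli z A" and ?Q' = "sieve_moduli z (insert p A)"
  have sub: "?Q \<subseteq> ?Q' \<union> (\<lambda>q. p * q) ` ?Q'"
  proof
    fix q assume q: "q \<in> ?Q"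
    show "q \<in> ?Q' \<union> (\<lambda>q. p * q) ` ?Q'"
    proof (cases "p dvd q")
      case False
      then show ?thesis using q by (auto simp: sieve_moduli_def)
    next
      case True
      then obtain k where k: "q = p * k" by blast
      have sf: "squarefree (p * k)" using q k by (simp add: sieve_moduli_def)
      then have "squarefree k" by (rule squarefree_multD)
      moreover have "\<not> p dvd k"
      proof
        assume "p dvd k"
        then have "p ^ 2 dvd p * k" by (simp add: power2_eq_square)
        then show False using sf p squarefreeD[of "p*k" p] by auto
      qed
      moreover have "0 < k" "k \<le> z"
        using q k p prime_gt_0_nat[of p]
        by (auto simp: sieve_moduli_def intro: order_trans[rotated])
      ultimately have "k \<in> ?Q'" using q k by (auto simp: sieve_moduli_def)
      then show ?thesis using k by blast
    qed
  qed
  have "(\<Sum>q\<in>?Q. 1 / real q) \<le> (\<Sum>q\<in>?Q' \<union> (\<lambda>q. p * q) ` ?Q'. 1 / real q)"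
    by (rule sum_mono2) (use sub in auto)
  also have "\<dots> = (\<Sum>q\<in>?Q'. 1 / real q) + (\<Sum>q\<in>(\<lambda>q. p * q) ` ?Q'. 1 / real q)"
    by (rule sum.union_disjoint) (auto simp: sieve_moduli_def)
  also have "(\<Sum>q\<in>(\<lambda>q. p * q) ` ?Q'. 1 / real q) = (\<Sum>q\<in>?Q'. 1 / real (p * q))"
    using p prime_gt_0_nat[of p] by (subst sum.reindex) (auto simp: inj_on_def)
  also have "\<dots> = (1 / real p) * (\<Sum>q\<in>?Q'. 1 / real q)"
    by (simp add: sum_distrib_left)
  finally show ?thesis by (simp add: algebra_simps)
qed

lemma sum_sieve_moduli_le_prod:
  assumes "finite A" "\<forall>r\<in>A. prime r"
  shows "(\<Sum>q\<in>sieve_moduli z {}. 1 / real q)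
         \<le> (\<Prod>p\<in>A. 1 + 1 / real p) * (\<Sum>q\<in>sieve_moduli z A. 1 / real q)"
  using assms
proof (induction A rule: finite_induct)
  case (insert p A)
  have "(\<Sum>q\<in>sieve_moduli z {}. 1 / real q)
         \<le> (\<Prod>p\<in>A. 1 + 1 / real p) * (\<Sum>q\<in>sieve_moduli z A. 1 / real q)"
    using insert by auto
  also have "\<dots> \<le> (\<Prod>p\<in>A. 1 + 1 / real p) *
      ((1 + 1 / real p) * (\<Sum>q\<in>sieve_moduli z (insert p A). 1 / real q))"
    using insert by (intro mult_left_mono sum_sieve_moduli_insert_le prod_nonneg) auto
  finally show ?case using insert by (simp add: mult_ac)
qed simp

text \<open>Expanding the product gives a sum over distinct integers: a finite part of the Euler product of the
zeta function.\<close>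

lemma prod_one_plus_powr_eq_sum:
  assumes "finite A" "\<forall>p\<in>A. prime (p::nat)"
  shows "\<exists>D. finite D \<and> 0 \<notin> D \<and> (\<forall>n\<in>D. \<forall>p. prime p \<longrightarrow> p dvd n \<longrightarrow> p \<in> A) \<and>
           (\<Prod>p\<in>A. 1 + real p powr s) = (\<Sum>n\<in>D. real n powr s)"
  using assms
proof (induction A rule: finite_induct)
  case empty
  show ?case by (rule exI[of _ "{1}"]) auto
next
  case (insert p A)
  then obtain D where D: "finite D" "0 \<notin> D" "\<forall>n\<in>D. \<forall>r. prime r \<longrightarrow> r dvd n \<longrightarrow> r \<in> A"
      "(\<Prod>p\<in>A. 1 + real p powr s) = (\<Sum>n\<in>D. real n powr s)"
    by auto
  have p: "prime p" using insert by auto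
  have disj: "D \<inter> (\<lambda>n. p * n) ` D = {}"
    using D(3) p insert(2) by auto
  have "(\<Prod>p\<in>insert p A. 1 + real p powr s) = (\<Sum>n\<in>D. real n powr s) + (\<Sum>n\<in>D. real (p * n) powr s)"
    using insert(1,2) by (simp add: D(4) algebra_simps sum_distrib_left sum.distrib powr_mult)
  also have "(\<Sum>n\<in>D. real (p * n) powr s) = (\<Sum>n\<in>(\<lambda>n. p * n) ` D. real n powr s)"
    using p prime_gt_0_nat[of p] by (subst sum.reindex) (auto simp: inj_on_def)
  also have "(\<Sum>n\<in>D. real n powr s) + \<dots> = (\<Sum>n\<in>D \<union> (\<lambda>n. p * n) ` D. real n powr s)"
    using D disj by (subst sum.union_disjoint) auto
  finally show ?case
    using D p prime_gt_0_nat[of p] insert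
    by (intro exI[of _ "D \<union> (\<lambda>n. p * n) ` D"])
       (auto simp: prime_dvd_mult_iff dest: primes_dvd_imp_eq)
qed

lemma sum_powr_le:
  fixes e :: real
  assumes e: "e > 0"
  shows "(\<Sum>n=1..X. real n powr (-1 - e)) \<le> 1 + 1 / e"
proof -
  have "(\<Sum>n=1..X. real n powr (-1 - e)) \<le> 1 + (1 - real X powr (-e)) / e" if "X \<ge> 1" for X
    using that
  proof (induction X rule: nat_induct_at_least)
    case base
    then show ?case by simp
  next
    case (Suc n)
    have n: "real n > 0" using Suc by simp
    then have pos: "1 + 1 / real n > 0" by (simp add: add_pos_pos)
    have l: "ln (1 + 1 / real n) \<ge> 1 / (real n + 1)"
    proof -
      have "ln (real n / (real n + 1)) \<le> real n / (real n + 1) - 1"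
        using n by (intro ln_le_minus_one) auto
      also have "ln (real n / (real n + 1)) = - ln (1 + 1 / real n)"
        using n by (simp add: ln_div field_simps)
      finally show ?thesis using n by (simp add: field_simps)
    qed
    have "real n powr (-e) = real (Suc n) powr (-e) * (1 + 1 / real n) powr e"
    proof -
      have "(1 + 1 / real n) = real (Suc n) / real n" using n by (simp add: field_simps)
      then show ?thesis using n by (simp add: powr_divide powr_minus field_simps)
    qed
    also have "(1 + 1 / real n) powr e = exp (e * ln (1 + 1 / real n))"
      using pos by (simp add: powr_def)
    also have "real (Suc n) powr (-e) * \<dots> \<ge> real (Suc n) powr (-e) * (1 + e * (1 / (real n + 1)))"
    proof (rule mult_left_mono)
      have "1 + e * (1 / (real n + 1)) \<le> 1 + e * ln (1 + 1 / real n)"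
        using l e by (intro add_left_mono mult_left_mono) auto
      also have "\<dots> \<le> exp (e * ln (1 + 1 / real n))" by (rule exp_ge_add_one_self)
      finally show "1 + e * (1 / (real n + 1)) \<le> exp (e * ln (1 + 1 / real n))" .
    qed simp
    finally have "real (Suc n) powr (-e) * e * (1 / (real n + 1)) \<le> real n powr (-e) - real (Suc n) powr (-e)"
      by (simp add: algebra_simps)
    moreover have "real (Suc n) powr (-1 - e) = real (Suc n) powr (-e) * (1 / (real n + 1))"
      by (simp add: powr_diff powr_minus field_simps)
    ultimately have "e * real (Suc n) powr (-1 - e) \<le> real n powr (-e) - real (Suc n) powr (-e)"
      by (simp add: mult_ac)
    then have "real (Suc n) powr (-1 - e) \<le> (real n powr (-e) - real (Suc n) powr (-e)) / e"
      using e by (simp add: field_simps)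
    then show ?case using Suc e by (simp add: diff_divide_distrib)
  qed
  moreover have "1 + (1 - real X powr (-e)) / e \<le> 1 + 1 / e"
    using e by (simp add: divide_right_mono)
  ultimately show ?thesis using e by (cases "X \<ge> 1") (force intro: order_trans)+
qed

lemma prod_prime_factors_le:
  assumes "m > 0" shows "\<Prod>{p. prime p \<and> p dvd m} \<le> (m::nat)"
proof -
  have "\<Prod>{p. prime p \<and> p dvd m} = \<Prod>(prime_factors m)"
    using assms by (intro arg_cong[of _ _ "\<lambda>x. \<Prod>x"]) (auto simp: prime_factors_dvd)
  also have "\<dots> \<le> (\<Prod>p\<in>prime_factors m. p ^ multiplicity p m)"
    using assms by (intro prod_mono) (auto simp: prime_factors_multiplicity self_le_power prime_gt_0_nat Suc_le_eq)
  also have "\<dots> = m" using assms by (metis prime_factorization_nat)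
  finally show ?thesis .
qed

lemma card_multiples: "p > 0 \<Longrightarrow> card {m\<in>{1..n}. p dvd m} = n div (p::nat)"
proof -
  assume p: "p > 0"
  have "{m\<in>{1..n}. p dvd m} = (\<lambda>k. p * k) ` {1..n div p}"
    using p by (auto simp: image_iff less_eq_div_iff_mult_less_eq mult_ac elim!: dvdE)
  then show ?thesis using p by (simp add: card_image inj_on_def)
qed

text \<open>Chebyshev's argument: \<open>\<Sum>p. (n div p) * ln p\<close> counts each \<open>ln p\<close> once for every multiple of \<open>p\<close> up to
\<open>n\<close>, hence is at most \<open>\<Sum>m\<le>n. ln m\<close>, and \<open>n div p \<ge> n / (2 p)\<close>.\<close>

lemma sum_ln_over_prime_le:
  fixes n :: nat
  assumes "n \<ge> 1"
  shows "(\<Sum>p | prime p \<and> p \<le> n. ln (real p) / real p) \<le> 2 * ln (real n)"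
proof -
  let ?A = "{p::nat. prime p \<and> p \<le> n}"
  have fin: "finite ?A" by (rule finite_subset[of _ "{..n}"]) auto
  have "(real n / 2) * (\<Sum>p\<in>?A. ln (real p) / real p) = (\<Sum>p\<in>?A. (real n / (2 * real p)) * ln (real p))"
    by (simp add: sum_distrib_left field_simps)
  also have "\<dots> \<le> (\<Sum>p\<in>?A. real (n div p) * ln (real p))"
  proof (intro sum_mono mult_right_mono)
    fix p assume p: "p \<in> ?A"
    then have p0: "p > 0" by (auto simp: prime_gt_0_nat)
    have "n div p \<ge> 1" using p p0 by (simp add: Suc_le_eq div_greater_zero_iff)
    moreover have "n = p * (n div p) + n mod p" by simp
    moreover have "n mod p < p" using p0 by simp
    moreover have "p * 1 \<le> p * (n div p)" using \<open>n div p \<ge> 1\<close> by (intro mult_left_mono) auto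
    ultimately have "n \<le> 2 * (p * (n div p))" by linarith
    then have "real n \<le> 2 * (real p * real (n div p))" by (metis of_nat_le_iff of_nat_mult of_nat_numeral)
    then show "real n / (2 * real p) \<le> real (n div p)" using p0 by (simp add: field_simps)
  qed (auto simp: prime_gt_0_nat Suc_le_eq)
  also have "\<dots> = (\<Sum>p\<in>?A. \<Sum>m\<in>{m\<in>{1..n}. p dvd m}. ln (real p))"
    by (intro sum.cong refl, subst sum_constant, subst card_multiples) (auto simp: prime_gt_0_nat)
  also have "\<dots> = (\<Sum>m\<in>{1..n}. \<Sum>p | p \<in> ?A \<and> p dvd m. ln (real p))"
    by (rule sum.swap_restrict) (use fin in auto)
  also have "\<dots> \<le> (\<Sum>m\<in>{1..n}. ln (real n))"
  proof (rule sum_mono)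
    fix m assume m: "m \<in> {1..n}"
    have eq: "{p. p \<in> ?A \<and> p dvd m} = {p. prime p \<and> p dvd m}"
      using m by (auto dest: dvd_imp_le)
    have "(\<Sum>p | p \<in> ?A \<and> p dvd m. ln (real p)) = ln (real (\<Prod>{p. prime p \<and> p dvd m}))"
      unfolding eq of_nat_prod using m by (subst ln_prod) (auto simp: prime_gt_0_nat)
    also have "\<dots> \<le> ln (real n)"
    proof (subst ln_le_cancel_iff)
      show "real (\<Prod>{p. prime p \<and> p dvd m}) \<le> real n"
        using prod_prime_factors_le[of m] m by (subst of_nat_le_iff) auto
    qed (use m in \<open>auto intro!: prod_pos simp: prime_gt_0_nat\<close>)
    finally show "(\<Sum>p | p \<in> ?A \<and> p dvd m. ln (real p)) \<le> ln (real n)" .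
  qed
  also have "\<dots> = real n * ln (real n)" by simp
  finally show ?thesis using assms by (simp add: field_simps)
qed

text \<open>The upper bound in Mertens' theorem. At the exponent \<open>1 + e\<close> with \<open>e = 1 / ln n\<close> the product is at most
\<open>\<zeta>(1 + e) \<le> 1 + ln n\<close>, and moving the exponent from \<open>1 + e\<close> to 1 costs a factor
\<open>exp (e * (\<Sum>p\<le>n. ln p / p))\<close>, which is bounded.\<close>

lemma prod_one_plus_inverse_prime_le:
  fixes n :: nat
  assumes n: "n \<ge> 2"
  shows "(\<Prod>p | prime p \<and> p \<le> n. 1 + 1 / real p) \<le> 3 * exp 2 * ln (real n)"
proof -
  let ?A = "{p::nat. prime p \<and> p \<le> n}"
  define e where "e = 1 / ln (real n)"
  have fin: "finite ?A" by (rule finite_subset[of _ "{..n}"]) auto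
  have ln0: "ln (real n) > 0" using n by simp
  then have e: "e > 0" by (simp add: e_def)
  have "(\<Prod>p\<in>?A. 1 + 1 / real p) \<le> (\<Prod>p\<in>?A. (1 + real p powr (-1 - e)) * exp (e * (ln (real p) / real p)))"
  proof (intro prod_mono conjI)
    fix p assume "p \<in> ?A"
    then have p: "real p \<ge> 1" "real p > 0" by (auto simp: prime_gt_0_nat Suc_le_eq)
    have "1 - e * ln (real p) \<le> real p powr (-e)"
      using exp_ge_add_one_self[of "-e * ln (real p)"] p by (simp add: powr_def)
    then have "(1 - real p powr (-e)) / real p \<le> (e * ln (real p)) / real p"
      using p by (intro divide_right_mono) auto
    moreover have "real p powr (-1 - e) = real p powr (-e) / real p"
      using powr_add[of "real p" "-e" "-1"] p by (simp add: powr_minus field_simps)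
    ultimately have "1 / real p - real p powr (-1 - e) \<le> e * (ln (real p) / real p)"
      by (simp add: diff_divide_distrib)
    then have "1 + 1 / real p \<le> 1 + real p powr (-1 - e) + e * (ln (real p) / real p)" by simp
    also have "\<dots> \<le> (1 + real p powr (-1 - e)) * (1 + e * (ln (real p) / real p))"
      using p e by (simp add: algebra_simps)
    also have "\<dots> \<le> (1 + real p powr (-1 - e)) * exp (e * (ln (real p) / real p))"
      by (intro mult_left_mono exp_ge_add_one_self) auto
    finally show "1 + 1 / real p \<le> \<dots>" .
  qed auto
  also have "\<dots> = (\<Prod>p\<in>?A. 1 + real p powr (-1 - e)) * exp (e * (\<Sum>p\<in>?A. ln (real p) / real p))"
    by (simp add: prod.distrib sum_distrib_left exp_sum fin)
  also have "\<dots> \<le> (1 + 1 / e) * exp 2"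
  proof (rule mult_mono)
    obtain D where D: "finite D" "0 \<notin> D" "(\<Prod>p\<in>?A. 1 + real p powr (-1-e)) = (\<Sum>n\<in>D. real n powr (-1-e))"
      using prod_one_plus_powr_eq_sum[OF fin, of "-1-e"] by blast
    have "(\<Sum>n\<in>D. real n powr (-1-e)) \<le> (\<Sum>n=1..Max D. real n powr (-1-e))"
    proof (rule sum_mono2)
      show "D \<subseteq> {1..Max D}"
        using D(1,2) by (auto simp: Suc_le_eq intro!: Nat.gr0I)
    qed auto
    also have "\<dots> \<le> 1 + 1 / e" by (rule sum_powr_le[OF e])
    finally show "(\<Prod>p\<in>?A. 1 + real p powr (-1-e)) \<le> 1 + 1 / e" using D by simp
    have "e * (\<Sum>p\<in>?A. ln (real p) / real p) \<le> e * (2 * ln (real n))"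
      using sum_ln_over_prime_le[of n] n e by (intro mult_left_mono) auto
    also have "\<dots> = 2" using ln0 by (simp add: e_def)
    finally show "exp (e * (\<Sum>p\<in>?A. ln (real p) / real p)) \<le> exp 2" by simp
  qed (use e in auto)
  also have "\<dots> \<le> (3 * ln (real n)) * exp 2"
  proof (rule mult_right_mono)
    have "ln (real n) \<ge> ln 2" using n by simp
    moreover have "ln (2::real) \<ge> 1/2" using ln2_ge_two_thirds by simp
    ultimately show "1 + 1 / e \<le> 3 * ln (real n)" by (simp add: e_def)
  qed auto
  finally show ?thesis by (simp add: mult_ac)
qed

text \<open>The quantity \<open>G\<close> of Selberg's sieve, whose upper bound for the number of survivors in an
interval of length \<open>N\<close> is about \<open>N / G\<close>.\<close>

definition totient_mass :: "nat \<Rightarrow> nat set \<Rightarrow> real" where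
  "totient_mass z A = (\<Sum>q\<in>sieve_moduli z A. 1 / real (totient q))"

lemma sum_inverse_le_totient_mass: "(\<Sum>q\<in>sieve_moduli z A. 1 / real q) \<le> totient_mass z A"
  unfolding totient_mass_def
  by (intro sum_mono divide_left_mono) (auto simp: sieve_moduli_def totient_le)

lemma totient_mass_ge:
  fixes n :: nat
  assumes n: "n \<ge> 2"
  shows "ln (real z + 1) \<le> 6 * exp 2 * ln (real n) * totient_mass z {p. prime p \<and> p \<le> n}"
proof -
  let ?A = "{p::nat. prime p \<and> p \<le> n}"
  have fin: "finite ?A" by (rule finite_subset[of _ "{..n}"]) auto
  have "ln (real z + 1) \<le> 2 * (\<Sum>q\<in>sieve_moduli z {}. 1 / real q)"
    by (rule ln_le_sum_inverse_squarefree)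
  also have "\<dots> \<le> 2 * ((\<Prod>p\<in>?A. 1 + 1 / real p) * (\<Sum>q\<in>sieve_moduli z ?A. 1 / real q))"
    by (intro mult_left_mono sum_sieve_moduli_le_prod fin) auto
  also have "\<dots> \<le> 2 * ((3 * exp 2 * ln (real n)) * totient_mass z ?A)"
    using n by (intro mult_left_mono mult_mono[OF prod_one_plus_inverse_prime_le[OF n] sum_inverse_le_totient_mass])
      (auto intro!: sum_nonneg)
  finally show ?thesis by simp
qed

section \<open>Exponential sums on a grid and at rational shifts\<close>

lemma e_char_add: "e_char (x + y) = e_char x * e_char y"
  by (simp add: e_char_def distrib_left exp_add)

lemma norm_e_char [simp]: "cmod (e_char x) = 1"
  by (simp add: e_char_def norm_exp_eq_Re)

lemma e_char_eq_cis: "e_char x = cis (2 * pi * x)"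
  by (simp add: e_char_def cis_conv_exp mult_ac)

lemma e_char_of_int [simp]: "e_char (of_int n) = 1"
  by (simp add: e_char_eq_cis cis_multiple_2pi)

lemma e_char_of_nat [simp]: "e_char (of_nat n) = 1"
  using e_char_of_int[of "int n"] by simp

lemma e_char_eq_1_iff: "e_char x = 1 \<longleftrightarrow> x \<in> \<int>"
proof
  assume "e_char x = 1"
  then obtain n :: int where "2 * pi * x = of_int (2 * n) * pi"
    by (auto simp: e_char_def exp_eq_1)
  then have "x = of_int n" by simp
  then show "x \<in> \<int>" by simp
qed (auto elim!: Ints_cases)

lemma e_char_power: "e_char x ^ n = e_char (real n * x)"
  by (induction n) (simp_all add: e_char_add distrib_right, simp add: e_char_def)

lemma sum_e_char_multiples:
  assumes H: "H > 0"
  shows "(\<Sum>j<H. e_char (of_int n * real j / real H)) = (if int H dvd n then of_nat H else 0)"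
proof (cases "int H dvd n")
  case True
  then obtain k where k: "n = int H * k" by blast
  have "e_char (of_int n * real j / real H) = 1" for j
  proof -
    have "of_int n * real j / real H = of_int (k * int j)" using H k by simp
    then show ?thesis by (simp only: e_char_of_int)
  qed
  then show ?thesis using True by simp
next
  case False
  let ?w = "e_char (of_int n / real H)"
  have w: "?w \<noteq> 1"
  proof
    assume "?w = 1"
    then obtain k where "of_int n / real H = of_int k" by (auto simp: e_char_eq_1_iff elim!: Ints_cases)
    then have "real_of_int n = of_int (int H * k)" using H by (simp add: field_simps)
    then have "n = int H * k" by (simp only: of_int_eq_iff)
    then show False using False by simp
  qed
  have "(\<Sum>j<H. e_char (of_int n * real j / real H)) = (\<Sum>j<H. ?w ^ j)"
    by (simp add: e_char_power mult_ac)
  also have "\<dots> = (?w ^ H - 1) / (?w - 1)" using w by (simp add: geometric_sum)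
  also have "?w ^ H = 1" using H by (simp add: e_char_power)
  finally show ?thesis using False by simp
qed

definition exp_sum :: "nat set \<Rightarrow> (nat \<Rightarrow> complex) \<Rightarrow> real \<Rightarrow> complex" where
  "exp_sum P u \<beta> = (\<Sum>p\<in>P. u p * e_char (real p * \<beta>))"

lemma exp_sum_add_nat [simp]: "exp_sum P u (x + real n) = exp_sum P u x"
proof -
  have "e_char (real p * (x + real n)) = e_char (real p * x)" for p
    using e_char_of_nat[of "p * n"] by (simp add: distrib_left e_char_add)
  then show ?thesis by (simp add: exp_sum_def)
qed

lemma exp_sum_shift: "exp_sum P u (x + y) = exp_sum P (\<lambda>p. u p * e_char (real p * y)) x"
  by (simp add: exp_sum_def distrib_left e_char_add mult_ac)

lemma exp_sum_mod_grid:
  assumes "H > 0"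
  shows "exp_sum P u (real (j mod H) / real H + x) = exp_sum P u (real j / real H + x)"
proof -
  have "j = H * (j div H) + j mod H" by simp
  then have "real j = real H * real (j div H) + real (j mod H)"
    by (metis of_nat_add of_nat_mult)
  then have "real j / real H + x = (real (j mod H) / real H + x) + real (j div H)"
    using assms by (simp add: field_simps)
  then show ?thesis by (simp only: exp_sum_add_nat)
qed

lemma inj_on_mod_window:
  fixes P :: "nat set"
  assumes P: "P \<subseteq> {m<..m + H}"
  shows "inj_on (\<lambda>p. p mod H) P"
proof (rule inj_onI)
  fix p q assume pq: "p \<in> P" "q \<in> P" "p mod H = q mod H"
  have "m < p" "p \<le> m + H" "m < q" "q \<le> m + H" using pq P by auto
  then have "\<bar>int p - int q\<bar> < int H" by linarith
  moreover have "int H dvd int p - int q"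
    by (metis mod_eq_dvd_iff of_nat_mod pq(3))
  ultimately show "p = q" using zdvd_imp_le[of "int H" "\<bar>int p - int q\<bar>"] by fastforce
qed

lemma parseval_grid:
  assumes H: "H > 0" and P: "finite P" "inj_on (\<lambda>p. p mod H) P"
  shows "(\<Sum>j<H. (cmod (exp_sum P u (real j / real H)))\<^sup>2) = real H * (\<Sum>p\<in>P. (cmod (u p))\<^sup>2)"
proof -
  have cnj: "cnj (e_char x) = e_char (-x)" for x
    by (simp add: e_char_eq_cis cis_cnj)
  have "complex_of_real (\<Sum>j<H. (cmod (exp_sum P u (real j / real H)))\<^sup>2)
      = (\<Sum>j<H. \<Sum>p\<in>P. \<Sum>r\<in>P. u p * cnj (u r) * e_char (of_int (int p - int r) * real j / real H))"
    unfolding of_real_sum complex_norm_square exp_sum_def cnj_sum sum_product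
  proof (intro sum.cong refl)
    fix j p r
    have "e_char (real p * (real j / real H)) * e_char (- (real r * (real j / real H)))
        = e_char (of_int (int p - int r) * real j / real H)"
      unfolding e_char_add[symmetric]
      by (rule arg_cong[of _ _ e_char]) (simp add: left_diff_distrib diff_divide_distrib)
    then show "u p * e_char (real p * (real j / real H)) * cnj (u r * e_char (real r * (real j / real H))) =
         u p * cnj (u r) * e_char (of_int (int p - int r) * real j / real H)"
      by (simp add: cnj mult_ac)
  qed
  also have "\<dots> = (\<Sum>p\<in>P. \<Sum>r\<in>P. u p * cnj (u r) * (\<Sum>j<H. e_char (of_int (int p - int r) * real j / real H)))"
    by (simp only: sum_distrib_left sum.swap[of _ _ "{..<H}"])
  also have "\<dots> = (\<Sum>p\<in>P. \<Sum>r\<in>P. if r = p then of_nat H * (u p * cnj (u p)) else 0)"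
  proof (intro sum.cong refl)
    fix p r assume pr: "p \<in> P" "r \<in> P"
    have "int H dvd int p - int r \<longleftrightarrow> p mod H = r mod H"
      by (metis mod_eq_dvd_iff of_nat_eq_iff of_nat_mod)
    also have "\<dots> \<longleftrightarrow> r = p" using P(2) pr by (auto simp: inj_on_def)
    finally show "u p * cnj (u r) * (\<Sum>j<H. e_char (of_int (int p - int r) * real j / real H)) =
        (if r = p then of_nat H * (u p * cnj (u p)) else 0)"
      unfolding sum_e_char_multiples[OF H] by simp
  qed
  also have "\<dots> = (\<Sum>p\<in>P. of_nat H * (u p * cnj (u p)))"
    using P(1) by (simp add: sum.delta')
  also have "\<dots> = complex_of_real (real H * (\<Sum>p\<in>P. (cmod (u p))\<^sup>2))"
    by (simp add: complex_norm_square[symmetric] sum_distrib_left)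
  finally show ?thesis by (simp only: of_real_eq_iff)
qed

text \<open>The sum over all \<open>a \<le> r q\<close> coprime to \<open>q\<close> vanishes, because each residue class modulo \<open>q\<close>
contributes a full sum of \<open>r\<close>-th roots of unity. The multiples of \<open>r\<close> among these \<open>a\<close> give the sum for
\<open>q\<close>, the others the sum for \<open>r q\<close>.\<close>

lemma sum_totatives_prime_mult:
  fixes r q n :: nat
  assumes r: "prime r" "\<not> r dvd q" "\<not> r dvd n" and q: "q > 0"
  shows "(\<Sum>a\<in>totatives (r * q). e_char (real n * (real a / real (r * q))))
         = - (\<Sum>a\<in>totatives q. e_char (real n * (real a / real q)))"
proof -
  have r0: "r > 0" using r(1) by (rule prime_gt_0_nat)
  let ?f = "\<lambda>a. e_char (real n * (real a / real (r * q)))"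
  define B where "B = {a\<in>{0<..r * q}. coprime a q}"
  have B1: "B = totatives (r * q) \<union> (\<lambda>a. r * a) ` totatives q"
  proof (intro set_eqI iffI)
    fix a assume a: "a \<in> B"
    show "a \<in> totatives (r * q) \<union> (\<lambda>a. r * a) ` totatives q"
    proof (cases "r dvd a")
      case True
      then obtain b where "a = r * b" by blast
      then show ?thesis using a r0 by (auto simp: B_def in_totatives_iff)
    next
      case False
      then have "coprime a r" using r(1) by (metis coprime_commute prime_imp_coprime)
      then show ?thesis using a by (auto simp: B_def in_totatives_iff)
    qed
  next
    fix a assume "a \<in> totatives (r * q) \<union> (\<lambda>a. r * a) ` totatives q"
    then show "a \<in> B"
      using r r0 q by (auto simp: B_def in_totatives_iff prime_imp_coprime)
  qed
  have disj: "totatives (r * q) \<inter> (\<lambda>a. r * a) ` totatives q = {}"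
    using r(1) by (auto simp: in_totatives_iff)
  have "(\<Sum>a\<in>B. ?f a) = (\<Sum>x\<in>totatives q \<times> {..<r}. ?f (fst x + q * snd x))"
  proof (rule sum.reindex_bij_witness[where i = "\<lambda>x. fst x + q * snd x"
        and j = "\<lambda>a. ((a - 1) mod q + 1, (a - 1) div q)"])
    fix a assume a: "a \<in> B"
    have e: "a = (a - 1) mod q + 1 + q * ((a - 1) div q)"
      using a mult_div_mod_eq[of q "a - 1"] by (simp add: B_def)
    then show "fst ((a - 1) mod q + 1, (a - 1) div q) + q * snd ((a - 1) mod q + 1, (a - 1) div q) = a"
      by simp
    have "coprime ((a - 1) mod q + 1) q"
    proof -
      have "gcd a q = gcd ((a - 1) mod q + 1) q"
        by (metis e gcd_add_mult gcd.commute mult.commute add.commute)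
      then show ?thesis using a by (simp add: B_def coprime_iff_gcd_eq_1)
    qed
    moreover have "(a - 1) mod q + 1 \<le> q" using q by (simp add: Suc_le_eq)
    moreover have "(a - 1) div q < r"
      by (rule less_mult_imp_div_less) (use a q r0 in \<open>auto simp: B_def\<close>)
    ultimately show "((a - 1) mod q + 1, (a - 1) div q) \<in> totatives q \<times> {..<r}"
      by (simp add: in_totatives_iff)
    show "?f (fst ((a - 1) mod q + 1, (a - 1) div q) + q * snd ((a - 1) mod q + 1, (a - 1) div q)) = ?f a"
      using e by simp
  next
    fix x assume x: "x \<in> totatives q \<times> {..<r}"
    obtain a j where xe: "x = (a, j)" by (cases x)
    have a: "a \<ge> 1" "a \<le> q" "coprime a q" "j < r" using x xe by (auto simp: in_totatives_iff)
    define b where "b = a - 1"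
    have b: "b < q" "a = b + 1" using a by (auto simp: b_def)
    have "(b + q * j) mod q = b" "(b + q * j) div q = j"
      using b(1) by auto
    then have "(a + q * j - 1) mod q = a - 1" "(a + q * j - 1) div q = j"
      using b(2) by auto
    then show "((fst x + q * snd x - 1) mod q + 1, (fst x + q * snd x - 1) div q) = x"
      using a xe by simp
    have "q * j + q \<le> q * r" using a mult_le_mono2[of "j + 1" r q] by (simp add: algebra_simps)
    moreover have "coprime (a + q * j) q"
      using a(3) by (metis gcd_add_mult gcd.commute mult.commute add.commute coprime_iff_gcd_eq_1)
    ultimately show "fst x + q * snd x \<in> B"
      using a xe by (simp add: B_def mult_ac)
  qed
  also have "\<dots> = (\<Sum>a\<in>totatives q. \<Sum>j<r. ?f (a + q * j))"
    by (simp add: sum.cartesian_product case_prod_unfold)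
  also have "\<dots> = (\<Sum>a\<in>totatives q. ?f a * (\<Sum>j<r. e_char (of_int (int n) * real j / real r)))"
    unfolding sum_distrib_left
  proof (intro sum.cong refl)
    fix a j
    have "real n * (real (a + q * j) / real (r * q))
        = real n * (real a / real (r * q)) + of_int (int n) * real j / real r"
      using q r0 by (simp add: field_simps)
    then show "?f (a + q * j) = ?f a * e_char (of_int (int n) * real j / real r)"
      by (simp only: e_char_add)
  qed
  also have "\<dots> = 0" using r unfolding sum_e_char_multiples[OF r0] by simp
  finally have "0 = (\<Sum>a\<in>B. ?f a)" by simp
  also have "\<dots> = (\<Sum>a\<in>totatives (r * q). ?f a) + (\<Sum>a\<in>(\<lambda>a. r * a) ` totatives q. ?f a)"
    unfolding B1 using disj by (intro sum.union_disjoint) auto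
  also have "(\<Sum>a\<in>(\<lambda>a. r * a) ` totatives q. ?f a) = (\<Sum>a\<in>totatives q. e_char (real n * (real a / real q)))"
    using r0 by (subst sum.reindex) (auto simp: inj_on_def)
  finally show ?thesis by (simp add: eq_neg_iff_add_eq_0)
qed

lemma ramanujan_sum_squarefree:
  fixes q n :: nat
  assumes "squarefree q" "coprime n q"
  shows "(\<Sum>a\<in>totatives q. e_char (real n * (real a / real q))) = (-1) ^ card (prime_factors q)"
  using assms
proof (induction q rule: less_induct)
  case (less q)
  have q0: "q > 0" using less.prems by (auto intro!: Nat.gr0I)
  show ?case
  proof (cases "q = 1")
    case True
    then show ?thesis by simp
  next
    case False
    then obtain r where r: "prime r" "r dvd q" using prime_factor_nat by blast
    then obtain k where k: "q = r * k" by blast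
    have nr: "\<not> r dvd k"
    proof
      assume "r dvd k"
      then have "r ^ 2 dvd q" by (simp add: k power2_eq_square)
      then show False using less.prems(1) r squarefreeD[of q r] by auto
    qed
    have k0: "k > 0" using q0 k by auto
    have nn: "\<not> r dvd n"
      using less.prems(2) r by (metis coprime_common_divisor not_prime_unit)
    have "k < q" using k k0 prime_gt_1_nat[OF r(1)] by simp
    moreover have "squarefree k" using less.prems(1) k squarefree_multD by blast
    moreover have "coprime n k" using less.prems(2) k by simp
    ultimately have IH: "(\<Sum>a\<in>totatives k. e_char (real n * (real a / real k))) = (-1) ^ card (prime_factors k)"
      by (rule less.IH)
    have "prime_factors q = insert r (prime_factors k)"
      using k k0 r by (simp add: prime_factors_product prime_prime_factors)
    then have "card (prime_factors q) = Suc (card (prime_factors k))"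
      using nr by (simp add: in_prime_factors_iff)
    then show ?thesis
      using sum_totatives_prime_mult[OF r(1) nr nn k0] IH k by simp
  qed
qed

text \<open>The sieve enters through this identity: if the frequencies are coprime to \<open>q\<close>, the sum at \<open>x\<close> is
determined by its values at the shifts \<open>x + a/q\<close>.\<close>

lemma sum_exp_sum_totatives:
  assumes q: "squarefree q" "\<forall>p\<in>P. coprime p q"
  shows "(\<Sum>a\<in>totatives q. exp_sum P u (x + real a / real q))
         = (-1) ^ card (prime_factors q) * exp_sum P u x"
proof -
  have "(\<Sum>a\<in>totatives q. exp_sum P u (x + real a / real q))
      = (\<Sum>p\<in>P. u p * e_char (real p * x) * (\<Sum>a\<in>totatives q. e_char (real p * (real a / real q))))"
    unfolding exp_sum_def sum_distrib_left
    by (subst sum.swap) (simp add: distrib_left e_char_add mult_ac)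
  also have "\<dots> = (\<Sum>p\<in>P. u p * e_char (real p * x) * (-1) ^ card (prime_factors q))"
    using q by (intro sum.cong refl arg_cong2[of _ _ _ _ "(*)"] ramanujan_sum_squarefree) auto
  finally show ?thesis by (simp add: exp_sum_def sum_distrib_left mult_ac)
qed

text \<open>A large sieve inequality with the supremum over whole cells of the grid. Inside a cell, with the
frequencies recentred at \<open>m\<close>, the sum is expanded in powers of \<open>\<beta> H\<close>; the \<open>i\<close>-th coefficient is, in
absolute value, \<open>(2 \<pi>) ^ i / i!\<close> times an exponential sum at the grid point whose coefficients are not larger than
\<open>u\<close>, and Parseval on the grid applies to each of them.\<close>

lemma exp_sum_cell_majorant:
  fixes P :: "nat set" and u :: "nat \<Rightarrow> complex"
  assumes H: "H > 0" and P: "P \<subseteq> {m<..m + H}"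
  shows "\<exists>s. (\<forall>j. s j \<ge> 0) \<and>
    (\<forall>j \<beta>. 0 \<le> \<beta> \<longrightarrow> \<beta> \<le> 1 / real H \<longrightarrow> cmod (exp_sum P u (real j / real H + \<beta>)) \<le> s (j mod H)) \<and>
    (\<Sum>j<H. (s j)\<^sup>2) \<le> exp (4 * pi) * real H * (\<Sum>p\<in>P. (cmod (u p))\<^sup>2)"
proof -
  have finP: "finite P" using P by (rule finite_subset) auto
  define U where "U = (\<Sum>p\<in>P. (cmod (u p))\<^sup>2)"
  define v where "v i p = u p * complex_of_real (((real p - real m) / real H) ^ i)" for i p
  define c where "c i j = cmod (exp_sum P (v i) (real j / real H))" for i :: nat and j :: nat
  define r where "r i = (2 * pi) ^ i / fact i" for i :: nat
  define s where "s j = (\<Sum>i. r i * c i j)" for j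
  have r0: "r i \<ge> 0" for i by (simp add: r_def)
  have c0: "c i j \<ge> 0" for i j by (simp add: c_def)
  have r_sums: "r sums exp (2 * pi)"
    using exp_converges[of "2 * pi"] by (simp add: r_def[abs_def] field_simps)
  have wt: "0 \<le> (real p - real m) / real H" "(real p - real m) / real H \<le> 1" if "p \<in> P" for p
    using P that H by (auto simp: field_simps)
  have v_le: "cmod (v i p) \<le> cmod (u p)" if "p \<in> P" for i p
  proof -
    have "((real p - real m) / real H) ^ i \<le> 1" by (rule power_le_one[OF wt[OF that]])
    moreover have "((real p - real m) / real H) ^ i \<ge> 0" by (rule zero_le_power[OF wt(1)[OF that]])
    ultimately show ?thesis by (simp only: v_def norm_mult norm_of_real abs_of_nonneg mult_left_le norm_ge_zero)
  qed
  have c_le: "c i j \<le> (\<Sum>p\<in>P. cmod (u p))" for i j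
    unfolding c_def exp_sum_def
    by (rule order_trans[OF norm_sum]) (auto intro!: sum_mono v_le simp: norm_mult)
  have summ: "summable (\<lambda>i. r i * c i j)" for j
  proof (rule summable_comparison_test')
    show "summable (\<lambda>i. r i * (\<Sum>p\<in>P. cmod (u p)))"
      using r_sums by (intro summable_mult2) (simp add: sums_iff)
    show "norm (r i * c i j) \<le> r i * (\<Sum>p\<in>P. cmod (u p))" for i
      using r0 c0 c_le by (simp add: mult_left_mono)
  qed
  have bound: "cmod (exp_sum P u (real j / real H + \<beta>)) \<le> s j"
    if b: "0 \<le> \<beta>" "\<beta> \<le> 1 / real H" for j \<beta>
  proof -
    define x where "x = complex_of_real (2 * pi * (\<beta> * real H)) * \<i>"
    have nx: "cmod x \<le> 2 * pi"
    proof -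
      have "\<beta> * real H \<le> 1" using b H by (simp add: field_simps)
      then show ?thesis using b by (simp add: x_def norm_mult)
    qed
    have summand: "(\<lambda>i. x ^ i / fact i * (v i p * e_char (real p * (real j / real H))))
         sums (u p * e_char (real p * (real j / real H)) * e_char ((real p - real m) * \<beta>))" for p
    proof -
      let ?y = "x * complex_of_real ((real p - real m) / real H)"
      have y: "exp ?y = e_char ((real p - real m) * \<beta>)"
        unfolding e_char_def x_def using H by (intro arg_cong[of _ _ exp]) (simp add: field_simps)
      have "(\<lambda>i. ?y ^ i /\<^sub>R fact i) sums exp ?y" by (rule exp_converges)
      from sums_mult[OF this, of "u p * e_char (real p * (real j / real H))"]
      have "(\<lambda>i. u p * e_char (real p * (real j / real H)) * (?y ^ i /\<^sub>R fact i)) sums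
          (u p * e_char (real p * (real j / real H)) * e_char ((real p - real m) * \<beta>))"
        unfolding y .
      moreover have "u p * e_char (real p * (real j / real H)) * (?y ^ i /\<^sub>R fact i)
          = x ^ i / fact i * (v i p * e_char (real p * (real j / real H)))" for i
        unfolding v_def power_mult_distrib scaleR_conv_of_real of_real_power
        by (simp add: divide_inverse mult_ac)
      ultimately show ?thesis by (simp only:)
    qed
    have "(\<lambda>i. \<Sum>p\<in>P. x ^ i / fact i * (v i p * e_char (real p * (real j / real H))))
        sums (\<Sum>p\<in>P. u p * e_char (real p * (real j / real H)) * e_char ((real p - real m) * \<beta>))"
      by (rule sums_sum) (rule summand)
    also have "(\<lambda>i. \<Sum>p\<in>P. x ^ i / fact i * (v i p * e_char (real p * (real j / real H))))
        = (\<lambda>i. x ^ i / fact i * exp_sum P (v i) (real j / real H))"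
      by (simp add: exp_sum_def sum_distrib_left)
    finally have sums: "(\<lambda>i. x ^ i / fact i * exp_sum P (v i) (real j / real H)) sums
       (\<Sum>p\<in>P. u p * e_char (real p * (real j / real H)) * e_char ((real p - real m) * \<beta>))" .
    have nb: "cmod (x ^ i / fact i * exp_sum P (v i) (real j / real H)) \<le> r i * c i j" for i
      unfolding norm_mult norm_divide norm_power norm_fact c_def r_def
      by (intro mult_right_mono divide_right_mono power_mono nx) auto
    have "cmod (\<Sum>p\<in>P. u p * e_char (real p * (real j / real H)) * e_char ((real p - real m) * \<beta>)) \<le> s j"
      unfolding s_def sums_unique[OF sums]
      by (rule norm_suminf_le[OF nb summ])
    moreover have "exp_sum P u (real j / real H + \<beta>) = e_char (real m * \<beta>) *
        (\<Sum>p\<in>P. u p * e_char (real p * (real j / real H)) * e_char ((real p - real m) * \<beta>))"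
    proof -
      have "e_char (real p * (real j / real H + \<beta>)) =
         e_char (real m * \<beta>) * (e_char (real p * (real j / real H)) * e_char ((real p - real m) * \<beta>))" for p
        unfolding e_char_add[symmetric] by (rule arg_cong[of _ _ e_char]) (simp add: algebra_simps)
      then show ?thesis by (simp add: exp_sum_def sum_distrib_left mult_ac)
    qed
    ultimately show ?thesis by (simp add: norm_mult)
  qed
  have inj: "inj_on (\<lambda>p. p mod H) P" by (rule inj_on_mod_window[OF P])
  have part: "(\<Sum>j<H. (\<Sum>i<n. r i * c i j)\<^sup>2) \<le> exp (4 * pi) * real H * U" for n
  proof -
    have rn: "(\<Sum>i<n. r i) \<le> exp (2 * pi)"
      using r_sums r0 sum_le_suminf[of r "{..<n}"] by (auto simp: sums_iff)
    have "(\<Sum>j<H. (\<Sum>i<n. r i * c i j)\<^sup>2) \<le> (\<Sum>j<H. (\<Sum>i<n. r i) * (\<Sum>i<n. r i * (c i j)\<^sup>2))"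
    proof (rule sum_mono)
      fix j
      have "(\<Sum>i<n. sqrt (r i) * (sqrt (r i) * c i j))\<^sup>2
          \<le> (\<Sum>i<n. (sqrt (r i))\<^sup>2) * (\<Sum>i<n. (sqrt (r i) * c i j)\<^sup>2)"
        by (rule Cauchy_Schwarz_ineq_sum)
      then show "(\<Sum>i<n. r i * c i j)\<^sup>2 \<le> (\<Sum>i<n. r i) * (\<Sum>i<n. r i * (c i j)\<^sup>2)"
        using r0 by (simp add: power_mult_distrib mult.assoc[symmetric])
    qed
    also have "\<dots> = (\<Sum>i<n. r i) * (\<Sum>i<n. r i * (\<Sum>j<H. (c i j)\<^sup>2))"
      by (simp add: sum_distrib_left sum.swap[of _ _ "{..<H}"])
    also have "\<dots> \<le> (\<Sum>i<n. r i) * (\<Sum>i<n. r i * (real H * U))"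
    proof (intro mult_left_mono sum_mono r0 sum_nonneg)
      fix i
      have "(\<Sum>j<H. (c i j)\<^sup>2) = real H * (\<Sum>p\<in>P. (cmod (v i p))\<^sup>2)"
        unfolding c_def by (rule parseval_grid[OF H finP inj])
      also have "\<dots> \<le> real H * U"
        unfolding U_def by (intro mult_left_mono sum_mono power_mono v_le) auto
      finally show "(\<Sum>j<H. (c i j)\<^sup>2) \<le> real H * U" .
    qed
    also have "\<dots> = (\<Sum>i<n. r i) * (\<Sum>i<n. r i) * (real H * U)"
      by (simp only: sum_distrib_right[symmetric] mult.assoc)
    also have "\<dots> \<le> exp (2 * pi) * exp (2 * pi) * (real H * U)"
      using rn r0 by (intro mult_right_mono mult_mono) (auto simp: U_def intro!: sum_nonneg mult_nonneg_nonneg)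
    also have "exp (2 * pi) * exp (2 * pi) = exp (4 * pi)" by (simp add: exp_add[symmetric])
    finally show ?thesis by (simp add: mult_ac)
  qed
  have "(\<Sum>j<H. (s j)\<^sup>2) \<le> exp (4 * pi) * real H * U"
  proof (rule LIMSEQ_le_const2)
    show "(\<lambda>n. \<Sum>j<H. (\<Sum>i<n. r i * c i j)\<^sup>2) \<longlonglongrightarrow> (\<Sum>j<H. (s j)\<^sup>2)"
      unfolding s_def by (intro tendsto_sum tendsto_power summable_LIMSEQ summ)
  qed (use part in auto)
  moreover have "s j \<ge> 0" for j
    unfolding s_def by (intro suminf_nonneg summ) (simp add: r0 c0)
  moreover have "s (j mod H) = s j" for j
    using exp_sum_mod_grid[OF H, of P _ j 0] by (simp add: s_def c_def)
  ultimately show ?thesis using bound by (intro exI[of _ s]) (auto simp: U_def)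
qed

section \<open>Large sieve for sifted frequencies\<close>

text \<open>The reduced fractions \<open>a/q\<close> in \<open>(0, 1]\<close>, as pairs \<open>(q, a)\<close>; the denominator 1 occurs with \<open>a = 1\<close>.\<close>

definition farey :: "nat \<Rightarrow> nat set \<Rightarrow> (nat \<times> nat) set" where
  "farey z A = Sigma (sieve_moduli z A) totatives"

definition frac_val :: "nat \<times> nat \<Rightarrow> real" where
  "frac_val x = real (snd x) / real (fst x)"

definition frac_weight :: "nat \<times> nat \<Rightarrow> real" where
  "frac_weight x = 1 / real (totient (fst x))"

text \<open>The point \<open>k/H + a/q\<close> of the circle lies in the cell \<open>[j/H, (j + 1)/H)\<close> for this \<open>j\<close>.\<close>

definition grid_cell :: "nat \<Rightarrow> nat \<Rightarrow> nat \<times> nat \<Rightarrow> nat" where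
  "grid_cell H k x = (k + H * snd x div fst x) mod H"

lemma finite_farey [simp]: "finite (farey z A)"
  by (simp add: farey_def)

lemma frac_weight_nonneg [simp]: "frac_weight x \<ge> 0"
  by (simp add: frac_weight_def)

lemma fareyD:
  assumes "x \<in> farey z A"
  shows "0 < fst x" "fst x \<le> z" "0 < snd x" "snd x \<le> fst x" "coprime (snd x) (fst x)"
    "fst x \<in> sieve_moduli z A"
  using assms by (auto simp: farey_def sieve_moduli_def in_totatives_iff)

lemma sum_frac_weight_sq:
  "(\<Sum>x | x \<in> farey z A \<and> Q (fst x). (frac_weight x)\<^sup>2)
   = (\<Sum>q | q \<in> sieve_moduli z A \<and> Q q. 1 / real (totient q))"
proof -
  have "{x \<in> farey z A. Q (fst x)} = Sigma {q \<in> sieve_moduli z A. Q q} totatives"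
    by (auto simp: farey_def)
  then have "(\<Sum>x | x \<in> farey z A \<and> Q (fst x). (frac_weight x)\<^sup>2)
      = (\<Sum>q | q \<in> sieve_moduli z A \<and> Q q. \<Sum>a\<in>totatives q. (1 / real (totient q))\<^sup>2)"
    by (simp only: frac_weight_def, subst sum.Sigma) (auto simp: case_prod_unfold)
  also have "\<dots> = (\<Sum>q | q \<in> sieve_moduli z A \<and> Q q. 1 / real (totient q))"
    by (intro sum.cong refl) (simp add: totient_def[symmetric] power2_eq_square)
  finally show ?thesis .
qed

lemma farey_eqI:
  assumes x: "x \<in> farey z A" and y: "y \<in> farey z A" and d: "frac_val x - frac_val y \<in> \<int>"
  shows "x = y"
proof -
  have "0 < frac_val x" "frac_val x \<le> 1" "0 < frac_val y" "frac_val y \<le> 1"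
    using fareyD[OF x] fareyD[OF y] by (auto simp: frac_val_def)
  moreover obtain n where n: "frac_val x - frac_val y = of_int n" using d by (auto elim: Ints_cases)
  ultimately have "\<bar>real_of_int n\<bar> < 1" by linarith
  then have "n = 0" by linarith
  then have "real (snd x) * real (fst y) = real (snd y) * real (fst x)"
    using n fareyD(1)[OF x] fareyD(1)[OF y] by (simp add: frac_val_def field_simps)
  then have "snd x * fst y = snd y * fst x" by (metis of_nat_eq_iff of_nat_mult)
  then have "snd x = snd y \<and> fst y = fst x"
    using fareyD(5)[OF x] fareyD(5)[OF y] coprime_crossproduct_nat[of "snd x" "fst x" "snd y" "fst y"]
    by simp
  then show ?thesis by (simp add: prod_eq_iff)
qed

lemma grid_cell_eqD:
  assumes H: "H > 0" and x: "x \<in> farey z A" and y: "y \<in> farey z A"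
    and c: "grid_cell H k x = grid_cell H k' y"
  shows "\<exists>n::int. \<bar>real k - real k' + real H * (frac_val x - frac_val y - of_int n)\<bar> < 1"
proof -
  have val: "real H * frac_val w = real (H * snd w div fst w) + real (H * snd w mod fst w) / real (fst w)"
       "real (H * snd w mod fst w) / real (fst w) < 1" if "w \<in> farey z A" for w
  proof -
    have "real (H * snd w) / real (fst w) = real (H * snd w div fst w) + real (H * snd w mod fst w) / real (fst w)"
      by (rule of_nat_of_nat_div_aux)
    then show "real H * frac_val w = real (H * snd w div fst w) + real (H * snd w mod fst w) / real (fst w)"
      by (simp add: frac_val_def)
    show "real (H * snd w mod fst w) / real (fst w) < 1" using fareyD(1)[OF that] by simp
  qed
  have "int H dvd int (k + H * snd x div fst x) - int (k' + H * snd y div fst y)"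
    using c unfolding grid_cell_def by (metis mod_eq_dvd_iff of_nat_mod)
  then obtain n where n: "int (k + H * snd x div fst x) - int (k' + H * snd y div fst y) = int H * n" by blast
  then have "real_of_int (int (k + H * snd x div fst x) - int (k' + H * snd y div fst y)) = real_of_int (int H * n)"
    by (rule arg_cong)
  then have n': "real k + real (H * snd x div fst x) - real k' - real (H * snd y div fst y) = real H * of_int n"
    by simp
  have "real k - real k' + real H * (frac_val x - frac_val y - of_int n)
     = real (H * snd x mod fst x) / real (fst x) - real (H * snd y mod fst y) / real (fst y)"
    using val(1)[OF x] val(1)[OF y] n' by (simp add: right_diff_distrib)
  moreover have "0 \<le> real (H * snd x mod fst x) / real (fst x)" "0 \<le> real (H * snd y mod fst y) / real (fst y)"
    by simp_all
  ultimately show ?thesis using val(2)[OF x] val(2)[OF y] by (intro exI[of _ n]) linarith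
qed

text \<open>The two differences agree modulo 1 up to less than \<open>2/H\<close>, and they are rationals whose denominators
multiply to at most \<open>z ^ 4 \<le> H/2\<close>.\<close>

lemma farey_difference_rigid:
  assumes H: "H > 0" "2 * z ^ 4 \<le> H"
    and F: "x1 \<in> farey z A" "y1 \<in> farey z A" "x2 \<in> farey z A" "y2 \<in> farey z A"
    and c: "grid_cell H k x1 = grid_cell H k' y1" "grid_cell H k x2 = grid_cell H k' y2"
  shows "(frac_val x1 - frac_val y1) - (frac_val x2 - frac_val y2) \<in> \<int>"
proof -
  obtain n1 :: int where n1: "\<bar>real k - real k' + real H * (frac_val x1 - frac_val y1 - of_int n1)\<bar> < 1"
    using grid_cell_eqD[OF H(1) F(1,2) c(1)] by blast
  obtain n2 :: int where n2: "\<bar>real k - real k' + real H * (frac_val x2 - frac_val y2 - of_int n2)\<bar> < 1"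
    using grid_cell_eqD[OF H(1) F(3,4) c(2)] by blast
  define D where "D = (frac_val x1 - frac_val y1) - (frac_val x2 - frac_val y2)"
  define n where "n = n1 - n2"
  define Q where "Q = real (fst x1) * real (fst y1) * (real (fst x2) * real (fst y2))"
  have "real H * (D - of_int n) =
      (real k - real k' + real H * (frac_val x1 - frac_val y1 - of_int n1)) -
      (real k - real k' + real H * (frac_val x2 - frac_val y2 - of_int n2))"
    by (simp add: D_def n_def algebra_simps)
  then have "\<bar>real H * (D - of_int n)\<bar> < 2" using n1 n2 by linarith
  then have Hd: "real H * \<bar>D - of_int n\<bar> < 2" by (simp add: abs_mult)
  have pos: "0 < fst x1" "0 < fst y1" "0 < fst x2" "0 < fst y2" using F fareyD(1) by blast+
  then have Q0: "Q > 0" by (simp add: Q_def)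
  have le: "fst x1 \<le> z" "fst y1 \<le> z" "fst x2 \<le> z" "fst y2 \<le> z" using F fareyD(2) by blast+
  have "Q \<le> real z * real z * (real z * real z)"
    unfolding Q_def using le by (intro mult_mono) auto
  also have "\<dots> = real (z ^ 4)" by (simp add: eval_nat_numeral)
  finally have "2 * Q \<le> real H" using H(2) by (metis (mono_tags, lifting) mult_le_cancel_left_pos of_nat_le_iff of_nat_mult of_nat_numeral order_trans zero_less_numeral)
  have "Q * (D - of_int n) = of_int
     ((int (snd x1) * int (fst y1) - int (snd y1) * int (fst x1)) * (int (fst x2) * int (fst y2))
      - (int (snd x2) * int (fst y2) - int (snd y2) * int (fst x2)) * (int (fst x1) * int (fst y1))
      - int (fst x1) * int (fst y1) * (int (fst x2) * int (fst y2)) * n)"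
    unfolding Q_def D_def frac_val_def using pos by (simp add: field_simps)
  then obtain w :: int where w: "Q * (D - of_int n) = of_int w" by blast
  have "2 * \<bar>real_of_int w\<bar> = (2 * Q) * \<bar>D - of_int n\<bar>"
    using Q0 by (simp add: w[symmetric] abs_mult)
  also have "\<dots> \<le> real H * \<bar>D - of_int n\<bar>"
    using \<open>2 * Q \<le> real H\<close> by (intro mult_right_mono) auto
  also have "\<dots> < 2" by (rule Hd)
  finally have "w = 0" by linarith
  then have "D = of_int n" using w Q0 by simp
  then show ?thesis unfolding D_def by simp
qed

lemma totient_mass_multiples_le:
  fixes r :: nat
  assumes r: "prime r"
  shows "(\<Sum>q | q \<in> sieve_moduli z A \<and> r dvd q. 1 / real (totient q))
         \<le> totient_mass z A / (real r - 1)"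
proof -
  let ?S = "{q \<in> sieve_moduli z A. r dvd q}"
  have r1: "real r - 1 > 0" using prime_gt_1_nat[OF r] by simp
  have *: "q div r \<in> sieve_moduli z A \<and> q = r * (q div r) \<and> totient q = (r - 1) * totient (q div r)"
    if q: "q \<in> ?S" for q
  proof -
    obtain k where k: "q = r * k" using q by auto
    have sf: "squarefree (r * k)" using q k by (simp add: sieve_moduli_def)
    have nr: "\<not> r dvd k"
    proof
      assume "r dvd k"
      then have "r ^ 2 dvd r * k" by (simp add: power2_eq_square)
      then show False using sf r squarefreeD[of "r * k" r] by auto
    qed
    have "k \<le> r * k" using prime_gt_0_nat[OF r] by simp
    also have "r * k \<le> z" using q k by (simp add: sieve_moduli_def)
    finally have "k \<in> sieve_moduli z A"
      using q k squarefree_multD[OF sf] by (auto simp: sieve_moduli_def)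
    moreover have "coprime r k" using nr r by (simp add: prime_imp_coprime)
    then have "totient q = (r - 1) * totient k"
      using r by (simp add: k totient_mult_coprime totient_prime)
    ultimately show ?thesis using k prime_gt_0_nat[OF r] by simp
  qed
  have "(\<Sum>q\<in>?S. 1 / real (totient q)) = (\<Sum>q\<in>?S. (1 / (real r - 1)) * (1 / real (totient (q div r))))"
    using * prime_gt_1_nat[OF r] by (intro sum.cong refl) (auto simp: of_nat_diff)
  also have "\<dots> = (1 / (real r - 1)) * (\<Sum>q\<in>?S. 1 / real (totient (q div r)))"
    by (simp only: sum_distrib_left)
  also have "(\<Sum>q\<in>?S. 1 / real (totient (q div r))) = (\<Sum>k\<in>(\<lambda>q. q div r) ` ?S. 1 / real (totient k))"
  proof (subst sum.reindex)
    show "inj_on (\<lambda>q. q div r) ?S" using * by (intro inj_onI) metis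
  qed simp
  also have "(1 / (real r - 1)) * \<dots> \<le> (1 / (real r - 1)) * totient_mass z A"
    unfolding totient_mass_def using r1 *
    by (intro mult_left_mono sum_mono2) auto
  finally show ?thesis by simp
qed

text \<open>All pairs of fractions that bring \<open>k/H\<close> and \<open>k'/H\<close> into a common cell have the same difference modulo
1. It is not an integer, so its reduced denominator has a prime factor, and this prime divides the product
of the two denominators of each pair.\<close>

lemma common_prime_of_pairs:
  assumes H: "H > 0" "2 * z ^ 4 \<le> H"
    and F: "x0 \<in> farey z A" "y0 \<in> farey z A" and c0: "grid_cell H k x0 = grid_cell H k' y0"
    and kk: "k < H" "k' < H" "k \<noteq> k'"
  shows "\<exists>r. prime r \<and> (\<forall>x\<in>farey z A. \<forall>y\<in>farey z A.
           grid_cell H k x = grid_cell H k' y \<longrightarrow> r dvd fst x \<or> r dvd fst y)"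
proof -
  define d where "d = frac_val x0 - frac_val y0"
  define D where "D = int (fst x0) * int (fst y0)"
  define n where "n = int (snd x0) * int (fst y0) - int (snd y0) * int (fst x0)"
  have D0: "D > 0" using fareyD(1)[OF F(1)] fareyD(1)[OF F(2)] by (simp add: D_def)
  have d: "d = of_int n / of_int D"
    using fareyD(1)[OF F(1)] fareyD(1)[OF F(2)] by (simp add: d_def n_def D_def frac_val_def field_simps)
  have nZ: "d \<notin> \<int>"
  proof
    assume "d \<in> \<int>"
    then have "x0 = y0" using farey_eqI[OF F] by (simp add: d_def)
    then have "(k + H * snd x0 div fst x0) mod H = (k' + H * snd x0 div fst x0) mod H"
      using c0 by (simp add: grid_cell_def)
    then have "int H dvd int (k + H * snd x0 div fst x0) - int (k' + H * snd x0 div fst x0)"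
      by (metis mod_eq_dvd_iff of_nat_mod)
    then have "int H dvd int k - int k'" by simp
    then have "int H dvd \<bar>int k - int k'\<bar>" by simp
    moreover have "\<bar>int k - int k'\<bar> < int H" "0 < \<bar>int k - int k'\<bar>" using kk by auto
    ultimately show False using zdvd_not_zless by blast
  qed
  define g where "g = gcd n D"
  have g0: "g > 0" using D0 by (simp add: g_def)
  have "g dvd D" "g dvd n" by (simp_all add: g_def)
  then obtain R w where R: "D = g * R" and w: "n = g * w" by (elim dvdE)
  have cop: "coprime w R"
  proof -
    have "coprime (n div g) (D div g)" unfolding g_def using D0 by (intro div_gcd_coprime) auto
    then show ?thesis using R w g0 by simp
  qed
  have R0: "R > 0" using D0 R g0 by (simp add: zero_less_mult_iff)
  have "R \<noteq> 1"
  proof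
    assume "R = 1"
    then have "d = of_int w" using d R w g0 by simp
    then show False using nZ by simp
  qed
  then have "nat R \<noteq> 1" using R0 by auto
  then obtain r where r: "prime r" "r dvd nat R" using prime_factor_nat by blast
  have rR: "int r dvd R" using r(2) R0 by (metis int_dvd_int_iff int_nat_eq less_imp_le)
  show ?thesis
  proof (intro exI[of _ r] conjI ballI impI r(1))
    fix x y assume xy: "x \<in> farey z A" "y \<in> farey z A" "grid_cell H k x = grid_cell H k' y"
    have "(frac_val x - frac_val y) - d \<in> \<int>"
      unfolding d_def by (rule farey_difference_rigid[OF H xy(1,2) F xy(3) c0])
    then obtain v where v: "(frac_val x - frac_val y) - d = of_int v" by (auto elim: Ints_cases)
    have pos: "0 < fst x" "0 < fst y" using xy fareyD(1) by blast+
    have dR: "d = of_int w / of_int R" using d R w g0 by simp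
    define q where "q = int (fst x) * int (fst y)"
    define m where "m = int (snd x) * int (fst y) - int (snd y) * int (fst x)"
    have "frac_val x - frac_val y = of_int m / of_int q"
      using pos by (simp add: m_def q_def frac_val_def field_simps)
    then have "real_of_int m / of_int q - of_int w / of_int R = of_int v" using v dR by simp
    moreover have "q > 0" using pos by (simp add: q_def)
    ultimately have "real_of_int (m * R - w * q) = real_of_int (v * (q * R))"
      using R0 by (simp add: field_simps)
    then have "m * R - w * q = v * (q * R)" by (simp only: of_int_eq_iff)
    then have "w * q = R * (m - v * q)" by (simp add: algebra_simps)
    then have "R dvd w * q" by simp
    then have "R dvd q" using cop by (simp add: coprime_commute coprime_dvd_mult_right_iff)
    then have "int r dvd int (fst x * fst y)" using rR by (simp add: q_def dvd_trans)
    then have "r dvd fst x * fst y" by (simp only: int_dvd_int_iff)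
    then show "r dvd fst x \<or> r dvd fst y" using r(1) by (simp add: prime_dvd_mult_iff)
  qed
qed

text \<open>How much the shifts of \<open>k/H\<close> and of \<open>k'/H\<close> by the weighted fractions interfere: the entry of a Gram
matrix that replaces the orthogonality of well-spaced points.\<close>

definition cell_overlap :: "nat \<Rightarrow> nat set \<Rightarrow> nat \<Rightarrow> nat \<Rightarrow> nat \<Rightarrow> real" where
  "cell_overlap z A H k k' =
     (\<Sum>w | w \<in> farey z A \<times> farey z A \<and> grid_cell H k (fst w) = grid_cell H k' (snd w).
        frac_weight (fst w) * frac_weight (snd w))"

text \<open>By rigidity either member of a pair determines the other, so Cauchy-Schwarz separates the two weights
without multiplicities.\<close>

lemma cell_overlap_le_sqrt:
  assumes H: "H > 0" "2 * z ^ 4 \<le> H"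
    and W: "W \<subseteq> {w \<in> farey z A \<times> farey z A. grid_cell H k (fst w) = grid_cell H k' (snd w)}"
  shows "(\<Sum>w\<in>W. frac_weight (fst w) * frac_weight (snd w))\<^sup>2
     \<le> (\<Sum>x\<in>fst ` W. (frac_weight x)\<^sup>2) * (\<Sum>y\<in>snd ` W. (frac_weight y)\<^sup>2)"
proof -
  have WD: "fst w \<in> farey z A" "snd w \<in> farey z A" "grid_cell H k (fst w) = grid_cell H k' (snd w)"
    if "w \<in> W" for w
    using subsetD[OF W that] by (auto simp: mem_Times_iff)
  have fst: "inj_on fst W"
  proof (rule inj_onI)
    fix v w assume vw: "v \<in> W" "w \<in> W" "fst v = fst w"
    have "(frac_val (fst v) - frac_val (snd v)) - (frac_val (fst w) - frac_val (snd w)) \<in> \<int>"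
      by (rule farey_difference_rigid[OF H, where k = k and k' = k' and A = A]) (use WD vw in blast)+
    then have "frac_val (snd w) - frac_val (snd v) \<in> \<int>" using vw by simp
    then have "snd w = snd v" using farey_eqI[of "snd w" z A "snd v"] WD vw by blast
    then show "v = w" using vw by (simp add: prod_eq_iff)
  qed
  have snd: "inj_on snd W"
  proof (rule inj_onI)
    fix v w assume vw: "v \<in> W" "w \<in> W" "snd v = snd w"
    have "(frac_val (fst v) - frac_val (snd v)) - (frac_val (fst w) - frac_val (snd w)) \<in> \<int>"
      by (rule farey_difference_rigid[OF H, where k = k and k' = k' and A = A]) (use WD vw in blast)+
    then have "frac_val (fst v) - frac_val (fst w) \<in> \<int>" using vw by simp
    then have "fst v = fst w" using farey_eqI[of "fst v" z A "fst w"] WD vw by blast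
    then show "v = w" using vw by (simp add: prod_eq_iff)
  qed
  show ?thesis
    using Cauchy_Schwarz_ineq_sum[of "\<lambda>w. frac_weight (fst w)" "\<lambda>w. frac_weight (snd w)" W]
    by (simp add: sum.reindex[OF fst] sum.reindex[OF snd])
qed

lemma totient_mass_pos: "z > 0 \<Longrightarrow> \<forall>p\<in>A. prime p \<Longrightarrow> totient_mass z A > 0"
proof -
  assume "z > 0" "\<forall>p\<in>A. prime p"
  then have "1 \<in> sieve_moduli z A" by (auto simp: sieve_moduli_def)
  then show ?thesis
    unfolding totient_mass_def by (intro sum_pos2[of _ 1]) auto
qed

lemma cell_overlap_diag:
  assumes H: "H > 0" "2 * z ^ 4 \<le> H" and z: "z > 0" and A: "\<forall>p\<in>A. prime p"
  shows "cell_overlap z A H k k \<le> totient_mass z A"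
proof -
  let ?W = "{w \<in> farey z A \<times> farey z A. grid_cell H k (fst w) = grid_cell H k (snd w)}"
  have G: "(\<Sum>x\<in>farey z A. (frac_weight x)\<^sup>2) = totient_mass z A"
    using sum_frac_weight_sq[of z A "\<lambda>_. True"] by (simp add: totient_mass_def)
  have "(cell_overlap z A H k k)\<^sup>2 \<le> (\<Sum>x\<in>fst ` ?W. (frac_weight x)\<^sup>2) * (\<Sum>y\<in>snd ` ?W. (frac_weight y)\<^sup>2)"
    unfolding cell_overlap_def by (rule cell_overlap_le_sqrt[OF H]) (rule order_refl)
  also have "\<dots> \<le> totient_mass z A * totient_mass z A"
    unfolding G[symmetric] by (intro mult_mono sum_mono2 sum_nonneg) auto
  finally show ?thesis
    using totient_mass_pos[OF z A] by (simp add: power2_eq_square[symmetric] power2_le_iff_abs_le)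
qed

text \<open>In each pair a prime \<open>r > K\<^sup>2\<close> divides one of the denominators. Moduli divisible by \<open>r\<close> have mass at
most \<open>G / (r - 1) \<le> G / K\<^sup>2\<close>, and Cauchy-Schwarz leaves the square root of this saving.\<close>

lemma cell_overlap_offdiag:
  assumes H: "H > 0" "2 * z ^ 4 \<le> H" and z: "z > 0" and K: "K > 0"
    and A: "A = {p. prime p \<and> p \<le> K\<^sup>2}" and kk: "k < H" "k' < H" "k \<noteq> k'"
  shows "cell_overlap z A H k k' \<le> 2 * totient_mass z A / real K"
proof -
  let ?W = "{w \<in> farey z A \<times> farey z A. grid_cell H k (fst w) = grid_cell H k' (snd w)}"
  let ?G = "totient_mass z A"
  have G: "(\<Sum>x\<in>farey z A. (frac_weight x)\<^sup>2) = ?G"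
    using sum_frac_weight_sq[of z A "\<lambda>_. True"] by (simp add: totient_mass_def)
  have G0: "?G > 0" using totient_mass_pos[OF z, of A] A by auto
  show ?thesis
  proof (cases "?W = {}")
    case True
    then show ?thesis unfolding cell_overlap_def True using G0 by simp
  next
    case False
    then obtain x0 y0 where xy0: "x0 \<in> farey z A" "y0 \<in> farey z A" "grid_cell H k x0 = grid_cell H k' y0"
      by auto
    obtain r where r: "prime r" "\<forall>x\<in>farey z A. \<forall>y\<in>farey z A.
           grid_cell H k x = grid_cell H k' y \<longrightarrow> r dvd fst x \<or> r dvd fst y"
      using common_prime_of_pairs[OF H xy0 kk] by blast
    define W1 where "W1 = {w \<in> ?W. r dvd fst (fst w)}"
    define W2 where "W2 = {w \<in> ?W. r dvd fst (snd w)}"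
    have "r dvd fst (fst w) \<or> r dvd fst (snd w)" if "w \<in> ?W" for w
      using bspec[OF bspec[OF r(2), of "fst w"], of "snd w"] that by (simp add: mem_Times_iff)
    then have W12: "?W = W1 \<union> W2" unfolding W1_def W2_def by blast
    have fin: "finite W1" "finite W2"
      by (rule finite_subset[of _ "farey z A \<times> farey z A"]; auto simp: W1_def W2_def)+
    \<comment> \<open>The moduli have no prime factor up to \<open>K\<^sup>2\<close>.\<close>
    have rK: "r > K\<^sup>2"
    proof (rule ccontr)
      assume "\<not> r > K\<^sup>2"
      then have "r \<in> A" using r(1) A by simp
      moreover have "r dvd fst x0 \<or> r dvd fst y0" using r(2) xy0 by blast
      ultimately show False using fareyD(6)[OF xy0(1)] fareyD(6)[OF xy0(2)] by (auto simp: sieve_moduli_def)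
    qed
    define G' where "G' = (\<Sum>x | x \<in> farey z A \<and> r dvd fst x. (frac_weight x)\<^sup>2)"
    have "G' \<le> ?G / (real r - 1)"
      unfolding G'_def sum_frac_weight_sq by (rule totient_mass_multiples_le[OF r(1)])
    also have "\<dots> \<le> ?G / (real K)\<^sup>2"
    proof (rule divide_left_mono)
      have "real (K\<^sup>2) + 1 \<le> real r" using rK by linarith
      then show "(real K)\<^sup>2 \<le> real r - 1" by simp
      then show "0 < (real r - 1) * (real K)\<^sup>2" using K
        by (smt (verit) mult_pos_pos of_nat_0_less_iff zero_less_power)
    qed (use G0 in simp)
    finally have G': "G' \<le> ?G / (real K)\<^sup>2" .
    have G'0: "G' \<ge> 0" unfolding G'_def by (intro sum_nonneg) auto
    have sq: "?G / (real K)\<^sup>2 * ?G = (?G / real K)\<^sup>2" by (simp add: power2_eq_square)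
    have "(\<Sum>w\<in>W1. frac_weight (fst w) * frac_weight (snd w))\<^sup>2
        \<le> (\<Sum>x\<in>fst ` W1. (frac_weight x)\<^sup>2) * (\<Sum>y\<in>snd ` W1. (frac_weight y)\<^sup>2)"
      by (rule cell_overlap_le_sqrt[OF H, of _ A k k']) (auto simp: W1_def)
    also have "\<dots> \<le> G' * ?G"
      unfolding G[symmetric] G'_def
      by (intro mult_mono sum_mono2 sum_nonneg) (auto simp: W1_def)
    also have "\<dots> \<le> ?G / (real K)\<^sup>2 * ?G" using G' G0 by (intro mult_right_mono) auto
    finally have 1: "(\<Sum>w\<in>W1. frac_weight (fst w) * frac_weight (snd w)) \<le> ?G / real K"
      unfolding sq using G0 by (auto intro: power2_le_imp_le)
    have "(\<Sum>w\<in>W2. frac_weight (fst w) * frac_weight (snd w))\<^sup>2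
        \<le> (\<Sum>x\<in>fst ` W2. (frac_weight x)\<^sup>2) * (\<Sum>y\<in>snd ` W2. (frac_weight y)\<^sup>2)"
      by (rule cell_overlap_le_sqrt[OF H, of _ A k k']) (auto simp: W2_def)
    also have "\<dots> \<le> ?G * G'"
      unfolding G[symmetric] G'_def
      by (intro mult_mono sum_mono2 sum_nonneg) (auto simp: W2_def)
    also have "\<dots> \<le> ?G / (real K)\<^sup>2 * ?G" using G' G0 by (subst mult.commute, intro mult_right_mono) auto
    finally have 2: "(\<Sum>w\<in>W2. frac_weight (fst w) * frac_weight (snd w)) \<le> ?G / real K"
      unfolding sq using G0 by (auto intro: power2_le_imp_le)
    have "cell_overlap z A H k k' = (\<Sum>w\<in>W1 \<union> W2. frac_weight (fst w) * frac_weight (snd w))"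
      unfolding cell_overlap_def W12[symmetric] ..
    also have "\<dots> \<le> (\<Sum>w\<in>W1. frac_weight (fst w) * frac_weight (snd w)) + (\<Sum>w\<in>W2. frac_weight (fst w) * frac_weight (snd w))"
      using sum.union_inter[OF fin, of "\<lambda>w. frac_weight (fst w) * frac_weight (snd w)"]
        sum_nonneg[of "W1 \<inter> W2" "\<lambda>w. frac_weight (fst w) * frac_weight (snd w)"] by simp
    finally show ?thesis using 1 2 by simp
  qed
qed

lemma sum_cells_eq_overlap:
  assumes H: "H > 0" and X: "finite X"
  shows "(\<Sum>j<H. (\<Sum>k\<in>X. \<Sum>x\<in>farey z A. if grid_cell H k x = j then a k * frac_weight x else 0)\<^sup>2)
    = (\<Sum>k\<in>X. \<Sum>k'\<in>X. a k * a k' * cell_overlap z A H k k')"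
proof -
  let ?F = "farey z A"
  let ?t = "\<lambda>j k x. if grid_cell H k x = j then a k * frac_weight x else 0"
  have "(\<Sum>j<H. (\<Sum>k\<in>X. \<Sum>x\<in>?F. ?t j k x)\<^sup>2)
      = (\<Sum>j<H. \<Sum>k\<in>X. \<Sum>k'\<in>X. \<Sum>x\<in>?F. \<Sum>y\<in>?F. ?t j k x * ?t j k' y)"
    by (simp only: power2_eq_square sum_product)
  also have "\<dots> = (\<Sum>k\<in>X. \<Sum>k'\<in>X. \<Sum>x\<in>?F. \<Sum>y\<in>?F. \<Sum>j<H. ?t j k x * ?t j k' y)"
    by (simp only: sum.swap[of _ _ "{..<H}"])
  also have "\<dots> = (\<Sum>k\<in>X. \<Sum>k'\<in>X. \<Sum>x\<in>?F. \<Sum>y\<in>?F.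
       if grid_cell H k x = grid_cell H k' y then a k * frac_weight x * (a k' * frac_weight y) else 0)"
  proof (intro sum.cong refl)
    fix k k' x y
    have "grid_cell H k x < H" using H by (simp add: grid_cell_def)
    have "(\<Sum>j<H. ?t j k x * ?t j k' y) = (\<Sum>j<H. if j = grid_cell H k x then
        (if grid_cell H k x = grid_cell H k' y then a k * frac_weight x * (a k' * frac_weight y) else 0) else 0)"
      by (intro sum.cong refl) auto
    also have "\<dots> = (if grid_cell H k x = grid_cell H k' y then a k * frac_weight x * (a k' * frac_weight y) else 0)"
      using \<open>grid_cell H k x < H\<close> by (subst sum.delta) auto
    finally show "(\<Sum>j<H. ?t j k x * ?t j k' y) = \<dots>" .
  qed
  also have "\<dots> = (\<Sum>k\<in>X. \<Sum>k'\<in>X. a k * a k' * cell_overlap z A H k k')"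
  proof (intro sum.cong refl)
    fix k k'
    have "cell_overlap z A H k k' = (\<Sum>w\<in>?F \<times> ?F. if grid_cell H k (fst w) = grid_cell H k' (snd w)
         then frac_weight (fst w) * frac_weight (snd w) else 0)"
      unfolding cell_overlap_def by (subst sum.inter_filter[symmetric]) (auto simp: Collect_conj_eq)
    also have "\<dots> = (\<Sum>x\<in>?F. \<Sum>y\<in>?F. if grid_cell H k x = grid_cell H k' y
         then frac_weight x * frac_weight y else 0)"
      by (simp add: sum.cartesian_product case_prod_unfold)
    finally show "(\<Sum>x\<in>?F. \<Sum>y\<in>?F. if grid_cell H k x = grid_cell H k' y
         then a k * frac_weight x * (a k' * frac_weight y) else 0) = a k * a k' * cell_overlap z A H k k'"
      by (simp add: sum_distrib_left if_distrib mult_ac cong: if_cong)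
  qed
  finally show ?thesis .
qed

text \<open>With \<open>G\<close> the total mass, \<open>G * \<bar>S(k/H)\<bar>\<close> is bounded by a weighted sum of cell maxima over the shifts
by \<open>a/q\<close>. Cauchy-Schwarz over the cells leaves the sum of the squared cell maxima, which is bounded by
\<open>exp_sum_cell_majorant\<close>, and a quadratic form with the entries \<open>cell_overlap\<close>. Each row of it sums to at
most \<open>G + K * (2 G / K) = 3 G\<close>.\<close>

lemma sifted_large_sieve:
  fixes P :: "nat set" and u :: "nat \<Rightarrow> complex"
  assumes H: "H > 0" "2 * z ^ 4 \<le> H" and z: "z > 0" and K: "K > 0"
    and A: "A = {p. prime p \<and> p \<le> K\<^sup>2}"
    and P: "P \<subseteq> {m<..m + H}" "\<forall>p\<in>P. \<forall>q\<in>sieve_moduli z A. coprime p q"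
    and X: "X \<subseteq> {..<H}" "card X \<le> K"
  shows "totient_mass z A * (\<Sum>k\<in>X. (cmod (exp_sum P u (real k / real H)))\<^sup>2)
         \<le> 3 * exp (4 * pi) * real H * (\<Sum>p\<in>P. (cmod (u p))\<^sup>2)"
proof -
  let ?F = "farey z A" and ?G = "totient_mass z A"
  define U where "U = (\<Sum>p\<in>P. (cmod (u p))\<^sup>2)"
  define a where "a k = cmod (exp_sum P u (real k / real H))" for k
  define V where "V = (\<Sum>k\<in>X. (a k)\<^sup>2)"
  have finX: "finite X" using X(1) by (rule finite_subset) auto
  have G0: "?G > 0" using totient_mass_pos[OF z, of A] A by auto
  have a0: "a k \<ge> 0" for k by (simp add: a_def)
  have V0: "V \<ge> 0" by (simp add: V_def sum_nonneg)
  have U0: "U \<ge> 0" by (simp add: U_def sum_nonneg)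
  obtain s where s: "\<And>j. s j \<ge> 0"
      "\<And>j \<beta>. 0 \<le> \<beta> \<Longrightarrow> \<beta> \<le> 1 / real H \<Longrightarrow> cmod (exp_sum P u (real j / real H + \<beta>)) \<le> s (j mod H)"
      "(\<Sum>j<H. (s j)\<^sup>2) \<le> exp (4 * pi) * real H * U"
    using exp_sum_cell_majorant[OF H(1) P(1), of u] unfolding U_def by metis
  define T where "T j = (\<Sum>k\<in>X. \<Sum>x\<in>?F. if grid_cell H k x = j then a k * frac_weight x else 0)" for j
  have pt: "?G * a k \<le> (\<Sum>x\<in>?F. frac_weight x * s (grid_cell H k x))" for k
  proof -
    have "?G * a k = (\<Sum>q\<in>sieve_moduli z A. 1 / real (totient q) * a k)"
      by (simp add: totient_mass_def sum_distrib_right)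
    also have "\<dots> \<le> (\<Sum>q\<in>sieve_moduli z A. \<Sum>b\<in>totatives q. frac_weight (q, b) * s (grid_cell H k (q, b)))"
    proof (rule sum_mono)
      fix q assume q: "q \<in> sieve_moduli z A"
      then have q0: "q > 0" by (simp add: sieve_moduli_def)
      have "a k = cmod (\<Sum>b\<in>totatives q. exp_sum P u (real k / real H + real b / real q))"
        using q P(2) by (subst sum_exp_sum_totatives) (auto simp: sieve_moduli_def a_def norm_mult norm_power)
      also have "\<dots> \<le> (\<Sum>b\<in>totatives q. cmod (exp_sum P u (real k / real H + real b / real q)))"
        by (rule norm_sum)
      also have "\<dots> \<le> (\<Sum>b\<in>totatives q. s (grid_cell H k (q, b)))"
      proof (rule sum_mono)
        fix b
        let ?\<beta> = "real (H * b mod q) / real q / real H"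
        have "real (H * b) / real q = real (H * b div q) + real (H * b mod q) / real q"
          by (rule of_nat_of_nat_div_aux)
        then have "real b / real q = (real (H * b div q) + real (H * b mod q) / real q) / real H"
          using H(1) by (simp add: field_simps)
        then have "real k / real H + real b / real q = real (k + H * b div q) / real H + ?\<beta>"
          by (simp add: add_divide_distrib)
        moreover have "real (H * b mod q) / real q \<le> 1" using q0 by simp
        then have "?\<beta> \<le> 1 / real H" by (intro divide_right_mono) auto
        moreover have "0 \<le> ?\<beta>" by simp
        ultimately show "cmod (exp_sum P u (real k / real H + real b / real q)) \<le> s (grid_cell H k (q, b))"
          using s(2)[of ?\<beta> "k + H * b div q"] by (simp add: grid_cell_def)
      qed
      finally have "1 / real (totient q) * a k \<le> 1 / real (totient q) * (\<Sum>b\<in>totatives q. s (grid_cell H k (q, b)))"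
        by (intro mult_left_mono) auto
      then show "1 / real (totient q) * a k \<le> (\<Sum>b\<in>totatives q. frac_weight (q, b) * s (grid_cell H k (q, b)))"
        by (simp add: frac_weight_def sum_distrib_left)
    qed
    also have "\<dots> = (\<Sum>x\<in>?F. frac_weight x * s (grid_cell H k x))"
      by (simp add: farey_def sum.Sigma case_prod_unfold)
    finally show ?thesis .
  qed
  have "?G * V = (\<Sum>k\<in>X. a k * (?G * a k))"
    by (simp add: V_def sum_distrib_left power2_eq_square mult_ac)
  also have "\<dots> \<le> (\<Sum>k\<in>X. a k * (\<Sum>x\<in>?F. frac_weight x * s (grid_cell H k x)))"
    by (intro sum_mono mult_left_mono pt a0)
  also have "\<dots> = (\<Sum>k\<in>X. \<Sum>x\<in>?F. \<Sum>j<H. s j * (if grid_cell H k x = j then a k * frac_weight x else 0))"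
    unfolding sum_distrib_left
  proof (intro sum.cong refl)
    fix k x
    have lt: "grid_cell H k x < H" using H by (simp add: grid_cell_def)
    have "(\<Sum>j<H. s j * (if grid_cell H k x = j then a k * frac_weight x else 0))
      = (\<Sum>j<H. if grid_cell H k x = j then s j * (a k * frac_weight x) else 0)"
      by (intro sum.cong refl) auto
    then show "a k * (frac_weight x * s (grid_cell H k x))
        = (\<Sum>j<H. s j * (if grid_cell H k x = j then a k * frac_weight x else 0))"
      using lt by (simp add: sum.delta mult_ac)
  qed
  also have "\<dots> = (\<Sum>j<H. s j * T j)"
    by (simp only: T_def sum_distrib_left sum.swap[of _ _ "{..<H}"])
  finally have "(?G * V)\<^sup>2 \<le> (\<Sum>j<H. s j * T j)\<^sup>2"
    using G0 V0 by (intro power_mono) auto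
  also have "\<dots> \<le> (\<Sum>j<H. (s j)\<^sup>2) * (\<Sum>j<H. (T j)\<^sup>2)"
    by (rule Cauchy_Schwarz_ineq_sum)
  also have "\<dots> \<le> (exp (4 * pi) * real H * U) * (3 * ?G * V)"
  proof (rule mult_mono)
    have ov: "cell_overlap z A H k k' \<le> (if k' = k then ?G else 2 * ?G / real K)"
      if "k \<in> X" "k' \<in> X" for k k'
      using that X(1) cell_overlap_diag[OF H z, of A k] cell_overlap_offdiag[OF H z K A, of k k'] A by auto
    have ov0: "cell_overlap z A H k k' \<ge> 0" for k k'
      by (auto simp: cell_overlap_def intro!: sum_nonneg)
    have row: "(\<Sum>k'\<in>X. if k' = k then ?G else 2 * ?G / real K) \<le> 3 * ?G" if k: "k \<in> X" for k
    proof -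
      have "(\<Sum>k'\<in>X. if k' = k then ?G else 2 * ?G / real K)
          \<le> (\<Sum>k'\<in>X. (if k' = k then ?G else 0) + 2 * ?G / real K)"
        using G0 by (intro sum_mono) auto
      also have "\<dots> = ?G + real (card X) * (2 * ?G / real K)"
        using k finX by (simp add: sum.distrib sum.delta')
      also have "\<dots> \<le> ?G + real K * (2 * ?G / real K)"
        using X(2) G0 by (intro add_left_mono mult_right_mono) auto
      finally show ?thesis using K by simp
    qed
    have "(\<Sum>j<H. (T j)\<^sup>2) = (\<Sum>k\<in>X. \<Sum>k'\<in>X. a k * a k' * cell_overlap z A H k k')"
      unfolding T_def by (rule sum_cells_eq_overlap[OF H(1) finX])
    also have "\<dots> \<le> (\<Sum>k\<in>X. \<Sum>k'\<in>X. ((a k)\<^sup>2 / 2 + (a k')\<^sup>2 / 2) * (if k' = k then ?G else 2 * ?G / real K))"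
    proof (intro sum_mono mult_mono ov ov0)
      fix k k'
      show "a k * a k' \<le> (a k)\<^sup>2 / 2 + (a k')\<^sup>2 / 2"
        using sum_squares_bound[of "a k" "a k'"] by simp
    qed auto
    also have "\<dots> = (\<Sum>k\<in>X. \<Sum>k'\<in>X. (a k)\<^sup>2 / 2 * (if k' = k then ?G else 2 * ?G / real K))
        + (\<Sum>k'\<in>X. \<Sum>k\<in>X. (a k')\<^sup>2 / 2 * (if k = k' then ?G else 2 * ?G / real K))"
      unfolding distrib_right sum.distrib
      by (subst (4) sum.swap) (simp only: eq_commute)
    also have "\<dots> = (\<Sum>k\<in>X. (a k)\<^sup>2 * (\<Sum>k'\<in>X. if k' = k then ?G else 2 * ?G / real K))"
      by (simp add: sum_distrib_left sum.distrib[symmetric])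
    also have "\<dots> \<le> (\<Sum>k\<in>X. (a k)\<^sup>2 * (3 * ?G))"
      by (intro sum_mono mult_left_mono row) auto
    also have "\<dots> = 3 * ?G * V" by (simp add: V_def sum_distrib_left mult_ac)
    finally show "(\<Sum>j<H. (T j)\<^sup>2) \<le> 3 * ?G * V" .
  qed (use s(3) U0 in \<open>auto intro!: sum_nonneg\<close>)
  finally have main: "(?G * V)\<^sup>2 \<le> (3 * exp (4 * pi) * real H * U) * (?G * V)" by (simp add: mult_ac)
  have "?G * V \<le> 3 * exp (4 * pi) * real H * U"
  proof (cases "?G * V = 0")
    case False
    then have "?G * V > 0" using G0 V0 by (simp add: less_le)
    then show ?thesis using main unfolding power2_eq_square by (rule mult_right_le_imp_le[rotated])
  next
    case True
    then show ?thesis using U0 by (metis exp_ge_zero mult_nonneg_nonneg of_nat_0_le_iff zero_le_numeral)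
  qed
  then show ?thesis by (simp add: V_def U_def a_def)
qed

section \<open>Large sieve for primes\<close>

text \<open>The level \<open>N powr (1/5)\<close> is small enough for the separation of the fractions and has a logarithm
comparable to \<open>ln N\<close>.\<close>

lemma sieve_level_exists:
  fixes N :: real
  assumes N: "N \<ge> 10 ^ 6"
  shows "\<exists>z::nat. z > 0 \<and> 2 * real z ^ 4 \<le> N \<and> real z < sqrt N \<and> ln N / 5 \<le> ln (real z + 1)"
proof -
  define z where "z = nat \<lfloor>N powr (1/5)\<rfloor>"
  have N0: "N > 0" using N by simp
  have y2: "N powr (1/5) \<ge> 2"
  proof -
    have "(2::real) = (2 ^ 5) powr (1/5)" by (simp add: powr_powr flip: powr_numeral)
    also have "\<dots> \<le> N powr (1/5)" using N by (intro powr_mono2) auto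
    finally show ?thesis .
  qed
  have zle: "real z \<le> N powr (1/5)" using y2 by (simp add: z_def)
  have zge: "N powr (1/5) < real z + 1" unfolding z_def using y2 by linarith
  have "z > 0" using y2 zge by (intro Nat.gr0I) auto
  moreover have "2 * real z ^ 4 \<le> N"
  proof -
    have "2 * real z ^ 4 \<le> N powr (1/5) * (N powr (1/5)) ^ 4"
      using y2 zle by (intro mult_mono power_mono) auto
    also have "\<dots> = N powr (1/5) * N powr (4/5)" using N0 by (simp add: powr_powr flip: powr_numeral)
    also have "\<dots> = N powr (1/5 + 4/5)" by (rule powr_add[symmetric])
    finally show ?thesis using N0 by simp
  qed
  moreover have "real z < sqrt N"
  proof -
    have "N powr (1/5) < N powr (1/2)" using N by (intro powr_less_mono) auto
    then show ?thesis using zle N0 by (simp add: powr_half_sqrt)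
  qed
  moreover have "ln N / 5 \<le> ln (real z + 1)"
  proof -
    have "ln N / 5 = ln (N powr (1/5))" using N0 by (simp add: ln_powr)
    also have "\<dots> \<le> ln (real z + 1)" using zge y2 by (subst ln_le_cancel_iff) auto
    finally show ?thesis .
  qed
  ultimately show ?thesis by blast
qed

lemma coprime_sieve_moduli:
  assumes "prime p" "z < p" "q \<in> sieve_moduli z A"
  shows "coprime p q"
proof -
  have "\<not> p dvd q" using assms(2,3) by (auto simp: sieve_moduli_def dest!: dvd_imp_le)
  then show ?thesis using assms(1) by (simp add: prime_imp_coprime)
qed

text \<open>The parameter of the sifted large sieve is \<open>2 * card X\<close> instead of \<open>card X\<close>, so that the logarithm of
the sifting limit is positive for a single point as well.\<close>

lemma prime_large_sieve:
  fixes N :: real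
  assumes N: "N \<ge> 10 ^ 6" and H: "N \<le> real H" "real H \<le> 2 * N"
    and P: "P \<subseteq> {m<..m + H}" "\<forall>p\<in>P. prime p \<and> sqrt N < real p"
    and X: "X \<subseteq> {..<H}" "X \<noteq> {}"
  shows "(\<Sum>k\<in>X. (cmod (exp_sum P u (real k / real H)))\<^sup>2)
         \<le> 360 * exp (4 * pi + 2) * (N / ln N) * (\<Sum>p\<in>P. (cmod (u p))\<^sup>2) * ln (2 * real (card X))"
proof -
  define K where "K = 2 * card X"
  define A where "A = {p. prime p \<and> p \<le> K\<^sup>2}"
  define U where "U = (\<Sum>p\<in>P. (cmod (u p))\<^sup>2)"
  define V where "V = (\<Sum>k\<in>X. (cmod (exp_sum P u (real k / real H)))\<^sup>2)"
  have N0: "N > 0" using N by simp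
  have lnN: "ln N > 0" using N by simp
  have H0: "H > 0" using H N by (intro Nat.gr0I) auto
  have finX: "finite X" using X(1) by (rule finite_subset) auto
  have cX: "card X > 0" using X(2) finX by (simp add: card_gt_0_iff)
  have "K \<ge> 2" using cX by (simp add: K_def)
  then have K4: "K\<^sup>2 \<ge> 2" by (simp add: power2_eq_square) (metis le_trans mult_le_mono mult.right_neutral one_le_numeral)
  obtain z :: nat where z: "z > 0" "2 * real z ^ 4 \<le> N" "real z < sqrt N" "ln N / 5 \<le> ln (real z + 1)"
    using sieve_level_exists[OF N] by blast
  let ?G = "totient_mass z A"
  have "real (2 * z ^ 4) \<le> real H" using z(2) H by simp
  then have zH: "2 * z ^ 4 \<le> H" by (simp only: of_nat_le_iff)
  have cop: "\<forall>p\<in>P. \<forall>q\<in>sieve_moduli z A. coprime p q"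
    using P(2) z(3) by (auto intro!: coprime_sieve_moduli)
  have ls: "?G * V \<le> 3 * exp (4 * pi) * real H * U"
    unfolding V_def U_def
    by (rule sifted_large_sieve[OF H0 zH z(1) _ A_def P(1) cop X(1)]) (use cX in \<open>auto simp: K_def\<close>)
  have lnK: "ln (real (K\<^sup>2)) = 2 * ln (2 * real (card X))"
  proof -
    have "real (K\<^sup>2) = (2 * real (card X)) ^ 2" by (simp add: K_def)
    then show ?thesis using cX by (simp only: ln_realpow)
  qed
  note z(4)
  also have "ln (real z + 1) \<le> 6 * exp 2 * ln (real (K\<^sup>2)) * ?G"
    unfolding A_def by (rule totient_mass_ge[OF K4])
  finally have G: "ln N \<le> 60 * exp 2 * ln (2 * real (card X)) * ?G" unfolding lnK by simp
  have V0: "V \<ge> 0" by (simp add: V_def sum_nonneg)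
  have l0: "ln (2 * real (card X)) > 0" using cX by simp
  have U0: "U \<ge> 0" by (simp add: U_def sum_nonneg)
  have "ln N * V \<le> 60 * exp 2 * ln (2 * real (card X)) * ?G * V"
    by (rule mult_right_mono[OF G V0])
  also have "\<dots> = 60 * exp 2 * ln (2 * real (card X)) * (?G * V)" by simp
  also have "\<dots> \<le> 60 * exp 2 * ln (2 * real (card X)) * (3 * exp (4 * pi) * (2 * N) * U)"
  proof (intro mult_left_mono order_trans[OF ls] mult_right_mono)
  qed (use H l0 U0 in auto)
  also have "\<dots> = 360 * exp (4 * pi + 2) * N * U * ln (2 * real (card X))"
    by (simp add: exp_add)
  finally show ?thesis using lnN unfolding V_def U_def by (simp add: field_simps)
qed

section \<open>From large values to moments\<close>

lemma sum_Suc_over_power2_le: "finite I \<Longrightarrow> (\<Sum>i\<in>I. (real i + 1) / 2 ^ i) \<le> 4"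
proof -
  assume I: "finite I"
  have "(\<Sum>i<n. (real i + 1) / 2 ^ i) = 4 - (2 * real n + 4) / 2 ^ n" for n
  proof (induction n)
    case (Suc n)
    show ?case unfolding sum.lessThan_Suc Suc by (simp add: field_simps)
  qed simp
  then have *: "(\<Sum>i<n. (real i + 1) / 2 ^ i) \<le> 4" for n by simp
  obtain n where "I \<subseteq> {..<n}" using I by (meson finite_nat_iff_bounded)
  then have "(\<Sum>i\<in>I. (real i + 1) / 2 ^ i) \<le> (\<Sum>i<n. (real i + 1) / 2 ^ i)"
    by (intro sum_mono2) auto
  then show ?thesis using *[of n] by simp
qed

text \<open>With \<open>B = sqrt D\<close>, class \<open>i\<close> consists of the values between \<open>B * 2 powr (- (i + 1) / t)\<close> and
\<open>B * 2 powr (- i / t)\<close>. The lower limit and the hypothesis bound the logarithm of the size of the class by a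
multiple of \<open>(i + 1) / t\<close>; so its square sum is at most \<open>D * (i + 1) / t\<close> up to a constant, and the
remaining power \<open>t\<close> contributes \<open>B powr t / 2 ^ i\<close>. The series over \<open>i\<close> converges.\<close>

lemma sum_powr_le_of_log_large_values:
  fixes a :: "'a \<Rightarrow> real" and D t :: real
  assumes X: "finite X" and a0: "\<And>k. k \<in> X \<Longrightarrow> a k \<ge> 0" and D: "D > 0" and t: "0 < t" "t \<le> 2"
    and lv: "\<And>Y. Y \<subseteq> X \<Longrightarrow> Y \<noteq> {} \<Longrightarrow> (\<Sum>k\<in>Y. (a k)\<^sup>2) \<le> D * ln (2 * real (card Y))"
  shows "(\<Sum>k\<in>X. a k powr (2 + t)) \<le> 48 * D powr (1 + t / 2) / t"
proof -
  define B where "B = sqrt D"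
  have B: "B > 0" "B\<^sup>2 = D" using D by (auto simp: B_def)
  have Bt: "B powr (2 + t) = D powr (1 + t / 2)"
    unfolding B_def using D by (simp add: powr_powr field_simps flip: powr_half_sqrt)
  have aB: "a k \<le> B" if k: "k \<in> X" for k
  proof (rule power2_le_imp_le)
    have "(a k)\<^sup>2 \<le> D * ln 2" using lv[of "{k}"] k by simp
    also have "\<dots> \<le> D * 1" using D ln_2_less_1 by (intro mult_left_mono) auto
    finally show "(a k)\<^sup>2 \<le> B\<^sup>2" using B by simp
  qed (use B in auto)
  define X' where "X' = {k\<in>X. a k > 0}"
  define ix where "ix k = nat \<lfloor>t * log 2 (B / a k)\<rfloor>" for k
  have finX': "finite X'" using X by (simp add: X'_def)
  have ix: "a k \<le> B * 2 powr (- real (ix k) / t)" "B * 2 powr (- (real (ix k) + 1) / t) \<le> a k"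
    if k: "k \<in> X'" for k
  proof -
    have ak: "a k > 0" "a k \<le> B" using k aB by (auto simp: X'_def)
    define y where "y = log 2 (B / a k)"
    have "y \<ge> 0" using ak B by (simp add: y_def)
    then have ty: "t * y \<ge> 0" using t by simp
    have e: "a k = B * 2 powr (- y)"
      using ak B by (simp add: y_def powr_minus powr_log_cancel)
    have "real (ix k) \<le> t * y" "t * y \<le> real (ix k) + 1"
      using ty unfolding ix_def y_def[symmetric] by linarith+
    then have "real (ix k) / t \<le> y" "y \<le> (real (ix k) + 1) / t"
      using t by (auto simp: field_simps)
    then have "- y \<le> - real (ix k) / t" "- (real (ix k) + 1) / t \<le> - y"
      by (simp_all only: minus_divide_left[symmetric] neg_le_iff_le)
    then show "a k \<le> B * 2 powr (- real (ix k) / t)" "B * 2 powr (- (real (ix k) + 1) / t) \<le> a k"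
      unfolding e using B by (intro mult_left_mono powr_mono; simp)+
  qed
  have cls: "(\<Sum>k | k \<in> X' \<and> ix k = i. a k powr (2 + t))
      \<le> 12 * B powr (2 + t) / t * ((real i + 1) / 2 ^ i)" (is "?L \<le> ?R") for i
  proof (cases "{k \<in> X'. ix k = i} = {}")
    case True
    then show ?thesis unfolding True using t by simp
  next
    case False
    define Y where "Y = {k \<in> X'. ix k = i}"
    define w where "w = (real i + 1) / t"
    have w0: "w \<ge> 1 / 2" using t by (simp add: w_def field_simps)
    have finY: "finite Y" using finX' by (simp add: Y_def)
    have cY: "card Y > 0" using False finY by (simp add: Y_def card_gt_0_iff)
    have sq: "(\<Sum>k\<in>Y. (a k)\<^sup>2) \<le> D * ln (2 * real (card Y))"
      using False by (intro lv) (auto simp: Y_def X'_def)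
    define n where "n = 2 * real (card Y)"
    have n2: "n \<ge> 2" using cY by (simp add: n_def)
    have "real (card Y) * (B * 2 powr (- w))\<^sup>2 = (\<Sum>k\<in>Y. (B * 2 powr (- w))\<^sup>2)" by simp
    also have "\<dots> \<le> (\<Sum>k\<in>Y. (a k)\<^sup>2)"
    proof (intro sum_mono power_mono)
      fix k assume "k \<in> Y"
      then have "k \<in> X'" "ix k = i" by (simp_all add: Y_def)
      then have "B * 2 powr (- (real i + 1) / t) \<le> a k" using ix(2) by blast
      then show "B * 2 powr (- w) \<le> a k" unfolding w_def minus_divide_left .
    qed (use B in auto)
    also have "\<dots> \<le> D * ln n" using sq by (simp add: n_def)
    finally have "D * (real (card Y) * (2 powr (- w))\<^sup>2) \<le> D * ln n"
      using B by (simp add: power_mult_distrib mult_ac)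
    then have "real (card Y) * (2 powr (- w))\<^sup>2 \<le> ln n" using D by simp
    moreover have "(2 powr (- w))\<^sup>2 = 4 powr (- w)"
    proof -
      have "(2 powr (- w))\<^sup>2 = 2 powr (- w) * 2 powr (- w)" by (simp add: power2_eq_square)
      also have "\<dots> = (2 * 2) powr (- w)" by (rule powr_mult[symmetric])
      finally show ?thesis by simp
    qed
    ultimately have "n \<le> 2 * (4 powr w * ln n)"
      by (simp add: n_def powr_minus field_simps)
    then have "ln n \<le> ln (2 * (4 powr w * ln n))" using n2 by (subst ln_le_cancel_iff) auto
    also have "\<dots> = ln 2 + w * ln 4 + ln (ln n)" using n2 by (simp add: ln_mult ln_powr)
    \<comment> \<open>This absorbs the logarithm of the hypothesis into the left-hand side.\<close>
    also have "ln (ln n) \<le> ln n / 2"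
    proof -
      have "ln (ln n / 2) \<le> ln n / 2 - 1" using n2 by (intro ln_le_minus_one) auto
      moreover have "ln (ln n / 2) = ln (ln n) - ln 2" using n2 by (simp add: ln_div)
      ultimately show ?thesis using ln_2_less_1 by linarith
    qed
    finally have "ln n \<le> 2 * ln 2 + w * (2 * ln 4)" by simp
    also have "\<dots> \<le> (4 * w) * ln 2 + w * (2 * ln 4)"
      using w0 by (intro add_right_mono mult_right_mono) auto
    also have "ln (4::real) = 2 * ln 2" using ln_realpow[of 2 2] by simp
    also have "4 * w * ln 2 + w * (2 * (2 * ln 2)) = (8 * w) * ln 2" by simp
    also have "\<dots> \<le> 12 * w * 1" using w0 ln_2_less_1 by (intro mult_mono) auto
    finally have lnn: "ln n \<le> 12 * w" by simp
    have "?L = (\<Sum>k\<in>Y. a k powr (2 + t))" by (simp add: Y_def)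
    also have "\<dots> \<le> (\<Sum>k\<in>Y. (B powr t / 2 ^ i) * (a k)\<^sup>2)"
    proof (rule sum_mono)
      fix k assume k: "k \<in> Y"
      then have ak: "a k > 0" by (simp add: Y_def X'_def)
      have "a k powr t \<le> (B * 2 powr (- real i / t)) powr t"
        using k ix(1)[of k] ak t by (intro powr_mono2) (auto simp: Y_def)
      also have "\<dots> = B powr t * 2 powr (- real i)" using B t by (simp add: powr_mult powr_powr)
      also have "\<dots> = B powr t / 2 ^ i" by (simp add: powr_minus powr_realpow field_simps)
      finally have "a k powr t * (a k)\<^sup>2 \<le> B powr t / 2 ^ i * (a k)\<^sup>2" by (intro mult_right_mono) auto
      then show "a k powr (2 + t) \<le> (B powr t / 2 ^ i) * (a k)\<^sup>2"
        using ak by (simp add: powr_add mult_ac)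
    qed
    also have "\<dots> = (B powr t / 2 ^ i) * (\<Sum>k\<in>Y. (a k)\<^sup>2)" by (simp only: sum_distrib_left)
    also have "\<dots> \<le> (B powr t / 2 ^ i) * (D * (12 * w))"
    proof (rule mult_left_mono)
      show "(\<Sum>k\<in>Y. (a k)\<^sup>2) \<le> D * (12 * w)"
        using order_trans[OF sq, of "D * (12 * w)"] lnn D by (simp add: n_def)
    qed simp
    also have "\<dots> = ?R" using B by (simp add: w_def powr_add field_simps)
    finally show ?thesis .
  qed
  have "(\<Sum>k\<in>X. a k powr (2 + t)) = (\<Sum>k\<in>X'. a k powr (2 + t))"
    using X a0 t by (intro sum.mono_neutral_right) (auto simp: X'_def less_le)
  also have "\<dots> = (\<Sum>i\<in>ix ` X'. \<Sum>k | k \<in> X' \<and> ix k = i. a k powr (2 + t))"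
    by (rule sum.image_gen[OF finX'])
  also have "\<dots> \<le> (\<Sum>i\<in>ix ` X'. 12 * B powr (2 + t) / t * ((real i + 1) / 2 ^ i))"
    by (rule sum_mono) (rule cls)
  also have "\<dots> = 12 * B powr (2 + t) / t * (\<Sum>i\<in>ix ` X'. (real i + 1) / 2 ^ i)"
    by (simp only: sum_distrib_left)
  also have "\<dots> \<le> 12 * B powr (2 + t) / t * 4"
    using t finX' by (intro mult_left_mono sum_Suc_over_power2_le) auto
  finally show ?thesis unfolding Bt by simp
qed

text \<open>The integral over the circle is the mean over all translates of the grid.\<close>

lemma integral_le_of_grid_sums:
  fixes g :: "real \<Rightarrow> real"
  assumes H: "H > 0" and g: "continuous_on UNIV g"
    and B: "\<And>\<alpha>. (\<Sum>k<H. g (\<alpha> + real k / real H)) \<le> B"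
  shows "integral {0..1} g \<le> B / real H"
proof -
  have int: "g integrable_on {a..b}" for a b
    by (rule integrable_continuous_real) (rule continuous_on_subset[OF g], simp)
  have gs: "continuous_on S (\<lambda>x. g (x + c))" for S c
    by (rule continuous_on_compose2[OF g]) (auto intro!: continuous_intros)
  have "integral {0..real n / real H} g = (\<Sum>k<n. integral {real k / real H..real (Suc k) / real H} g)" for n
  proof (induction n)
    case (Suc n)
    have "integral {0..real (Suc n) / real H} g
       = integral {0..real n / real H} g + integral {real n / real H..real (Suc n) / real H} g"
      by (rule Henstock_Kurzweil_Integration.integral_combine[symmetric])
         (use int H in \<open>auto simp: divide_right_mono\<close>)
    then show ?case using Suc by simp
  qed simp
  from this[of H] have "integral {0..1} g = (\<Sum>k<H. integral {real k / real H..real (Suc k) / real H} g)"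
    using H by simp
  also have "\<dots> = (\<Sum>k<H. integral {0..1 / real H} (\<lambda>x. g (x + real k / real H)))"
  proof (intro sum.cong refl)
    fix k
    have "integral {real k / real H - real k / real H..real (Suc k) / real H - real k / real H} (\<lambda>x. g (x + real k / real H))
        = integral {real k / real H..real (Suc k) / real H} g"
      by (rule integral_shift_real_ivl)
    moreover have "real (Suc k) / real H - real k / real H = 1 / real H" by (simp add: add_divide_distrib)
    ultimately show "integral {real k / real H..real (Suc k) / real H} g
        = integral {0..1 / real H} (\<lambda>x. g (x + real k / real H))" by simp
  qed
  also have "\<dots> = integral {0..1 / real H} (\<lambda>x. \<Sum>k<H. g (x + real k / real H))"
    by (rule integral_sum[symmetric]) (auto intro!: integrable_continuous_real gs)
  also have "\<dots> \<le> integral {0..1 / real H} (\<lambda>x. B)"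
    by (rule integral_le) (auto intro!: integrable_continuous_real continuous_intros gs B)
  also have "\<dots> = B / real H" by simp
  finally show ?thesis .
qed

lemma sum_integrals_le_integral:
  fixes g :: "real \<Rightarrow> real" and c :: "'a \<Rightarrow> real"
  assumes F: "finite F" and g: "continuous_on UNIV g" "\<And>x. g x \<ge> 0"
    and c: "\<And>x. x \<in> F \<Longrightarrow> \<eta> \<le> c x \<and> c x \<le> 1"
    and sep: "\<And>x y. x \<in> F \<Longrightarrow> y \<in> F \<Longrightarrow> x \<noteq> y \<Longrightarrow> \<eta> < \<bar>c x - c y\<bar>"
  shows "(\<Sum>x\<in>F. integral {c x - \<eta>..c x} g) \<le> integral {0..1} g"
proof -
  have int: "g integrable_on {a..b}" for a b
    by (rule integrable_continuous_real) (rule continuous_on_subset[OF g(1)], simp)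
  have U: "(g has_integral (\<Sum>x\<in>F. integral {c x - \<eta>..c x} g)) (\<Union>x\<in>F. {c x - \<eta>..c x})"
  proof (rule has_integral_UN[OF F])
    show "pairwise (\<lambda>x y. negligible ({c x - \<eta>..c x} \<inter> {c y - \<eta>..c y})) F"
    proof (rule pairwiseI)
      fix x y assume "x \<in> F" "y \<in> F" "x \<noteq> y"
      then have "\<eta> < \<bar>c x - c y\<bar>" by (rule sep)
      then have "{c x - \<eta>..c x} \<inter> {c y - \<eta>..c y} = {}" by auto
      then show "negligible ({c x - \<eta>..c x} \<inter> {c y - \<eta>..c y})" by simp
    qed
  qed (use int in \<open>auto simp: has_integral_integral[symmetric]\<close>)
  have "(\<Sum>x\<in>F. integral {c x - \<eta>..c x} g) = integral (\<Union>x\<in>F. {c x - \<eta>..c x}) g"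
    using U by (simp add: integral_unique)
  also have "\<dots> \<le> integral {0..1} g"
  proof (rule integral_subset_le)
    show "(\<Union>x\<in>F. {c x - \<eta>..c x}) \<subseteq> {0..1}" using c by force
    show "g integrable_on (\<Union>x\<in>F. {c x - \<eta>..c x})" using U by blast
  qed (use int g in auto)
  finally show ?thesis .
qed

lemma sum_powr_le_card_powr_mult:
  fixes y :: "'a \<Rightarrow> real"
  assumes S: "finite S" and y: "\<And>i. i \<in> S \<Longrightarrow> y i \<ge> 0" and l: "l \<ge> 1"
  shows "(\<Sum>i\<in>S. y i) powr l \<le> real (card S) powr (l - 1) * (\<Sum>i\<in>S. y i powr l)"
proof -
  define T where "T = {i\<in>S. y i > 0}"
  have finT: "finite T" using S by (simp add: T_def)
  have sumT: "(\<Sum>i\<in>S. y i) = (\<Sum>i\<in>T. y i)" "(\<Sum>i\<in>S. y i powr l) = (\<Sum>i\<in>T. y i powr l)"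
    using S y l by (auto intro!: sum.mono_neutral_right simp: T_def less_le)
  show ?thesis
  proof (cases "T = {}")
    case True
    then show ?thesis by (simp add: sumT)
  next
    case False
    let ?n = "real (card T)"
    have n: "?n > 0" using False finT by (simp add: card_gt_0_iff)
    have "(\<Sum>i\<in>T. (1 / ?n) *\<^sub>R y i) powr l \<le> (\<Sum>i\<in>T. (1 / ?n) * (y i powr l))"
      using n finT False by (intro convex_on_sum[OF _ _ powr_convex[OF l]]) (auto simp: T_def)
    then have "((1 / ?n) * (\<Sum>i\<in>T. y i)) powr l \<le> (1 / ?n) * (\<Sum>i\<in>T. y i powr l)"
      by (simp add: sum_distrib_left)
    moreover have "((1 / ?n) * (\<Sum>i\<in>T. y i)) powr l = (\<Sum>i\<in>T. y i) powr l / ?n powr l"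
      using n by (simp add: powr_divide sum_nonneg T_def)
    ultimately have "(\<Sum>i\<in>T. y i) powr l / ?n powr l \<le> (1 / ?n) * (\<Sum>i\<in>T. y i powr l)"
      by (simp only:)
    then have "(\<Sum>i\<in>T. y i) powr l \<le> (1 / ?n) * (\<Sum>i\<in>T. y i powr l) * ?n powr l"
      using n by (subst (asm) pos_divide_le_eq) auto
    also have "\<dots> = ?n powr (l - 1) * (\<Sum>i\<in>T. y i powr l)"
      using n by (simp add: powr_diff field_simps)
    also have "\<dots> \<le> real (card S) powr (l - 1) * (\<Sum>i\<in>T. y i powr l)"
      using S l by (intro mult_right_mono powr_mono2) (auto simp: T_def intro!: sum_nonneg card_mono)
    finally show ?thesis by (simp add: sumT)
  qed
qed

lemma continuous_on_norm_exp_sum_powr: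
  "l > 0 \<Longrightarrow> continuous_on S (\<lambda>\<alpha>. cmod (exp_sum P u \<alpha>) powr l)"
  unfolding exp_sum_def e_char_def
  by (intro continuous_on_powr' continuous_intros) auto

section \<open>Lower bound for the sum over primes\<close>

text \<open>After recentring at \<open>m\<close> all summands have an argument of at most \<open>\<pi>/3\<close> in absolute value.\<close>

lemma norm_exp_sum_near_0_ge:
  assumes P: "P \<subseteq> {m<..m + H}" and H: "H > 0" and \<beta>: "\<bar>\<beta>\<bar> \<le> 1 / (6 * real H)"
  shows "real (card P) / 2 \<le> cmod (exp_sum P (\<lambda>_. 1) \<beta>)"
proof -
  have "real (card P) / 2 = (\<Sum>p\<in>P. 1 / 2)" by simp
  also have "\<dots> \<le> (\<Sum>p\<in>P. Re (e_char ((real p - real m) * \<beta>)))"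
  proof (rule sum_mono)
    fix p assume "p \<in> P"
    then have p: "0 \<le> real p - real m" "real p - real m \<le> real H" using P by auto
    have "\<bar>(real p - real m) * \<beta>\<bar> \<le> real H * (1 / (6 * real H))"
      unfolding abs_mult using p \<beta> by (intro mult_mono) auto
    also have "\<dots> = 1 / 6" using H by simp
    finally have x: "\<bar>2 * pi * ((real p - real m) * \<beta>)\<bar> \<le> pi / 3" by (simp add: abs_mult)
    have "1 / 2 = cos (pi / 3)" by (simp add: cos_60)
    also have "\<dots> \<le> cos \<bar>2 * pi * ((real p - real m) * \<beta>)\<bar>"
      using x by (intro cos_monotone_0_pi_le) auto
    finally show "1 / 2 \<le> Re (e_char ((real p - real m) * \<beta>))"
      by (simp add: e_char_eq_cis)
  qed
  also have "\<dots> = Re (\<Sum>p\<in>P. e_char ((real p - real m) * \<beta>))" by simp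
  also have "\<dots> \<le> cmod (\<Sum>p\<in>P. e_char ((real p - real m) * \<beta>))" by (rule complex_Re_le_cmod)
  also have "exp_sum P (\<lambda>_. 1) \<beta> = e_char (real m * \<beta>) * (\<Sum>p\<in>P. e_char ((real p - real m) * \<beta>))"
    unfolding exp_sum_def sum_distrib_left e_char_add[symmetric]
    by (intro sum.cong refl) (simp add: algebra_simps)
  then have "cmod (\<Sum>p\<in>P. e_char ((real p - real m) * \<beta>)) = cmod (exp_sum P (\<lambda>_. 1) \<beta>)"
    by (simp add: norm_mult)
  finally show ?thesis .
qed

text \<open>The arcs of length \<open>1 / (6 H)\<close> to the left of the fractions \<open>a/q\<close> are disjoint subsets of \<open>[0, 1]\<close>. On
the arcs of one denominator the moment is bounded below by convexity and \<open>sum_exp_sum_totatives\<close>.\<close>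

lemma integral_exp_sum_powr_ge:
  fixes l :: real
  assumes P: "P \<subseteq> {m<..m + H}" "\<forall>p\<in>P. \<forall>q\<in>sieve_moduli z {}. coprime p q"
    and H: "H > 0" "2 * z ^ 4 \<le> H" and l: "l \<ge> 1"
  shows "(\<Sum>q\<in>sieve_moduli z {}. real (totient q) powr (1 - l)) / (6 * real H) * (real (card P) / 2) powr l
         \<le> integral {0..1} (\<lambda>\<alpha>. cmod (exp_sum P (\<lambda>_. 1) \<alpha>) powr l)"
proof -
  let ?Q = "sieve_moduli z {}" and ?F = "farey z {}"
  define g where "g \<alpha> = cmod (exp_sum P (\<lambda>_. 1) \<alpha>) powr l" for \<alpha>
  define \<eta> where "\<eta> = 1 / (6 * real H)"
  have \<eta>0: "\<eta> > 0" using H by (simp add: \<eta>_def)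
  have g: "continuous_on S g" for S
    unfolding g_def[abs_def] using l by (intro continuous_on_norm_exp_sum_powr) auto
  have gs: "continuous_on S (\<lambda>x. g (x + c))" for S c
    by (rule continuous_on_compose2[OF g[of UNIV]]) (auto intro!: continuous_intros)
  have pt: "(\<Sum>q\<in>?Q. real (totient q) powr (1 - l)) * (real (card P) / 2) powr l \<le> (\<Sum>x\<in>?F. g (\<beta> + frac_val x))"
    if \<beta>: "\<beta> \<in> {-\<eta>..0}" for \<beta>
  proof -
    have "(\<Sum>q\<in>?Q. real (totient q) powr (1 - l)) * (real (card P) / 2) powr l
       = (\<Sum>q\<in>?Q. real (totient q) powr (1 - l) * (real (card P) / 2) powr l)" by (rule sum_distrib_right)
    also have "\<dots> \<le> (\<Sum>q\<in>?Q. \<Sum>a\<in>totatives q. g (\<beta> + real a / real q))"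
    proof (rule sum_mono)
      fix q assume q: "q \<in> ?Q"
      then have tq: "real (totient q) > 0" by (simp add: sieve_moduli_def)
      have "real (card P) / 2 \<le> cmod (exp_sum P (\<lambda>_. 1) \<beta>)"
        using \<beta> by (intro norm_exp_sum_near_0_ge[OF P(1) H(1)]) (auto simp: \<eta>_def)
      also have "\<dots> = cmod (\<Sum>a\<in>totatives q. exp_sum P (\<lambda>_. 1) (\<beta> + real a / real q))"
        using q P(2) by (subst sum_exp_sum_totatives) (auto simp: sieve_moduli_def norm_mult norm_power)
      also have "\<dots> \<le> (\<Sum>a\<in>totatives q. cmod (exp_sum P (\<lambda>_. 1) (\<beta> + real a / real q)))"
        by (rule norm_sum)
      finally have "(real (card P) / 2) powr l
          \<le> (\<Sum>a\<in>totatives q. cmod (exp_sum P (\<lambda>_. 1) (\<beta> + real a / real q))) powr l"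
        using l by (intro powr_mono2) auto
      also have "\<dots> \<le> real (totient q) powr (l - 1) * (\<Sum>a\<in>totatives q. g (\<beta> + real a / real q))"
        unfolding g_def totient_def using l by (intro sum_powr_le_card_powr_mult) auto
      finally have "real (totient q) powr (1 - l) * (real (card P) / 2) powr l
         \<le> real (totient q) powr (1 - l) * (real (totient q) powr (l - 1) * (\<Sum>a\<in>totatives q. g (\<beta> + real a / real q)))"
        by (intro mult_left_mono) auto
      also have "\<dots> = (\<Sum>a\<in>totatives q. g (\<beta> + real a / real q))"
        using tq by (simp add: mult.assoc[symmetric] powr_add[symmetric])
      finally show "real (totient q) powr (1 - l) * (real (card P) / 2) powr l
         \<le> (\<Sum>a\<in>totatives q. g (\<beta> + real a / real q))" .
    qed
    also have "\<dots> = (\<Sum>x\<in>?F. g (\<beta> + frac_val x))"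
      by (subst sum.Sigma) (auto simp: farey_def frac_val_def case_prod_unfold)
    finally show ?thesis .
  qed
  have sep: "1 / (real z * real z) > \<eta>" if "z > 0"
  proof -
    have "z ^ 2 * 1 \<le> z ^ 2 * (z ^ 2)" using that by (intro mult_left_mono) auto
    then have "z ^ 2 \<le> z ^ 4" by (simp add: power_add[symmetric])
    then have "z * z \<le> H" using H(2) by (simp add: power2_eq_square)
    then have "real (z * z) \<le> real H" by (simp only: of_nat_le_iff)
    then have "real z * real z < 6 * real H" using H(1) by simp
    then show ?thesis using that H unfolding \<eta>_def by (intro divide_strict_left_mono) auto
  qed
  have fv: "\<eta> \<le> frac_val x \<and> frac_val x \<le> 1" if x: "x \<in> ?F" for x
  proof -
    note d = fareyD[OF x]
    have "z > 0" using d by simp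
    have "1 / (real z * real z) \<le> 1 / real z"
      using \<open>z > 0\<close> by (simp add: field_simps)
    also have "\<dots> \<le> real (snd x) / real (fst x)" using d by (intro frac_le) auto
    finally show ?thesis using sep[OF \<open>z > 0\<close>] d by (simp add: frac_val_def)
  qed
  have fsep: "\<eta> < \<bar>frac_val x - frac_val y\<bar>" if x: "x \<in> ?F" and y: "y \<in> ?F" and ne: "x \<noteq> y" for x y
  proof -
    note dx = fareyD[OF x] and dy = fareyD[OF y]
    define w where "w = int (snd x) * int (fst y) - int (snd y) * int (fst x)"
    have e: "frac_val x - frac_val y = of_int w / (real (fst x) * real (fst y))"
      using dx dy by (simp add: frac_val_def w_def field_simps)
    have "w \<noteq> 0"
    proof
      assume "w = 0"
      then have "frac_val x - frac_val y \<in> \<int>" using e by simp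
      then show False using farey_eqI[OF x y] ne by simp
    qed
    then have "1 \<le> \<bar>real_of_int w\<bar>" by linarith
    then have "1 / (real z * real z) \<le> \<bar>real_of_int w\<bar> / (real (fst x) * real (fst y))"
      using dx dy by (intro frac_le mult_mono) auto
    also have "\<dots> = \<bar>frac_val x - frac_val y\<bar>" by (simp add: e abs_mult)
    finally show ?thesis using sep dx by simp
  qed
  have "(\<Sum>q\<in>?Q. real (totient q) powr (1 - l)) / (6 * real H) * (real (card P) / 2) powr l
      = integral {-\<eta>..0} (\<lambda>\<beta>. (\<Sum>q\<in>?Q. real (totient q) powr (1 - l)) * (real (card P) / 2) powr l)"
    using \<eta>0 by (simp add: \<eta>_def)
  also have "\<dots> \<le> integral {-\<eta>..0} (\<lambda>\<beta>. \<Sum>x\<in>?F. g (\<beta> + frac_val x))"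
    by (rule integral_le) (auto intro!: integrable_continuous_real continuous_intros gs pt)
  also have "\<dots> = (\<Sum>x\<in>?F. integral {-\<eta>..0} (\<lambda>\<beta>. g (\<beta> + frac_val x)))"
    by (rule integral_sum) (auto intro!: integrable_continuous_real gs)
  also have "\<dots> = (\<Sum>x\<in>?F. integral {frac_val x - \<eta>..frac_val x} g)"
  proof (intro sum.cong refl)
    fix x
    show "integral {-\<eta>..0} (\<lambda>\<beta>. g (\<beta> + frac_val x)) = integral {frac_val x - \<eta>..frac_val x} g"
      using integral_shift_real_ivl[of "frac_val x - \<eta>" "frac_val x" "frac_val x" g] by simp
  qed
  also have "\<dots> \<le> integral {0..1} g"
    by (rule sum_integrals_le_integral) (use g fv fsep in \<open>auto simp: g_def\<close>)
  finally show ?thesis unfolding g_def .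
qed

text \<open>Up to \<open>Y\<close> the perturbation \<open>q powr t\<close> is harmless, so the sum is at least as large as for \<open>t = 0\<close>, up
to a constant.\<close>

lemma sum_totient_powr_ge:
  fixes t :: real
  assumes "t \<ge> 0" "real Y powr t \<le> exp 1" "Y \<le> z"
  shows "ln (real Y + 1) / (2 * exp 1) \<le> (\<Sum>q\<in>sieve_moduli z {}. real (totient q) powr (- 1 - t))"
proof -
  have "ln (real Y + 1) / 2 \<le> (\<Sum>q\<in>sieve_moduli Y {}. 1 / real q)"
    using ln_le_sum_inverse_squarefree[of Y] by simp
  then have "ln (real Y + 1) / 2 / exp 1 \<le> (\<Sum>q\<in>sieve_moduli Y {}. 1 / real q) / exp 1"
    by (rule divide_right_mono) simp
  also have "\<dots> = (\<Sum>q\<in>sieve_moduli Y {}. 1 / (real q * exp 1))"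
    by (simp add: sum_divide_distrib)
  also have "\<dots> \<le> (\<Sum>q\<in>sieve_moduli Y {}. real (totient q) powr (- 1 - t))"
  proof (rule sum_mono)
    fix q assume "q \<in> sieve_moduli Y {}"
    then have q: "0 < q" "q \<le> Y" by (auto simp: sieve_moduli_def)
    have tq: "0 < real (totient q)" "real (totient q) \<le> real q" using q by (auto simp: totient_le)
    have "real (totient q) powr (1 + t) = real (totient q) * real (totient q) powr t"
      using tq by (simp add: powr_add)
    also have "\<dots> \<le> real q * exp 1"
    proof (rule mult_mono)
      have "real (totient q) powr t \<le> real Y powr t" using tq q assms by (intro powr_mono2) auto
      then show "real (totient q) powr t \<le> exp 1" using assms by simp
    qed (use tq in auto)
    finally have "1 / (real q * exp 1) \<le> 1 / real (totient q) powr (1 + t)"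
      using tq q by (intro divide_left_mono) auto
    also have "\<dots> = real (totient q) powr (- 1 - t)" using tq by (simp add: powr_minus[symmetric] divide_inverse)
    finally show "1 / (real q * exp 1) \<le> real (totient q) powr (- 1 - t)" .
  qed
  also have "\<dots> \<le> (\<Sum>q\<in>sieve_moduli z {}. real (totient q) powr (- 1 - t))"
    using assms by (intro sum_mono2) (auto simp: sieve_moduli_def)
  finally show ?thesis by (simp add: mult_ac)
qed

section \<open>Comparison of the two moments\<close>

lemma grid_moment_exp_sum_le:
  fixes N :: real
  assumes N: "N \<ge> 10 ^ 6" and H: "N \<le> real H" "real H \<le> 2 * N"
    and P: "P \<subseteq> {m<..m + H}" "\<forall>p\<in>P. prime p \<and> sqrt N < real p"
    and U: "(\<Sum>p\<in>P. (cmod (u p))\<^sup>2) \<le> R" "R > 0" and t: "0 < t" "t \<le> 2"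
  shows "(\<Sum>k<H. cmod (exp_sum P u (\<alpha> + real k / real H)) powr (2 + t))
         \<le> 48 * (360 * exp (4 * pi + 2) * (N / ln N) * R) powr (1 + t / 2) / t"
proof -
  let ?D = "360 * exp (4 * pi + 2) * (N / ln N) * R"
  define v where "v p = u p * e_char (real p * \<alpha>)" for p
  have shift: "exp_sum P u (\<alpha> + x) = exp_sum P v x" for x
    using exp_sum_shift[of P u x \<alpha>] by (simp add: v_def[abs_def] add.commute)
  have lnN: "ln N > 0" using N by simp
  have D: "?D > 0" using N lnN U(2) by simp
  have "(\<Sum>k\<in>{..<H}. cmod (exp_sum P v (real k / real H)) powr (2 + t)) \<le> 48 * ?D powr (1 + t / 2) / t"
  proof (rule sum_powr_le_of_log_large_values[OF _ _ D t])
    fix Y assume Y: "Y \<subseteq> {..<H}" "Y \<noteq> {}"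
    then have "finite Y" by (auto intro: finite_subset)
    then have c: "1 \<le> real (card Y)" using Y by (simp add: Suc_le_eq card_gt_0_iff)
    have "(\<Sum>k\<in>Y. (cmod (exp_sum P v (real k / real H)))\<^sup>2)
        \<le> 360 * exp (4 * pi + 2) * (N / ln N) * (\<Sum>p\<in>P. (cmod (v p))\<^sup>2) * ln (2 * real (card Y))"
      by (rule prime_large_sieve[OF N H P Y])
    also have "\<dots> \<le> ?D * ln (2 * real (card Y))"
      using U(1) c N lnN by (intro mult_right_mono mult_left_mono) (auto simp: v_def norm_mult)
    finally show "(\<Sum>k\<in>Y. (cmod (exp_sum P v (real k / real H)))\<^sup>2) \<le> ?D * ln (2 * real (card Y))" .
  qed auto
  then show ?thesis by (simp add: shift)
qed

lemma norm_exp_sum_le: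
  assumes "finite P" "(\<Sum>p\<in>P. (cmod (u p))\<^sup>2) \<le> real (card P)"
  shows "cmod (exp_sum P u x) \<le> real (card P)"
proof -
  have "cmod (exp_sum P u x) \<le> (\<Sum>p\<in>P. 1 * cmod (u p))"
    unfolding exp_sum_def by (rule order_trans[OF norm_sum]) (simp add: norm_mult)
  also have "\<dots> \<le> real (card P)"
  proof (rule power2_le_imp_le)
    have "(\<Sum>p\<in>P. 1 * cmod (u p))\<^sup>2 \<le> (\<Sum>p\<in>P. 1\<^sup>2) * (\<Sum>p\<in>P. (cmod (u p))\<^sup>2)"
      by (rule Cauchy_Schwarz_ineq_sum)
    also have "\<dots> \<le> real (card P) * real (card P)" using assms by (simp add: mult_left_mono)
    finally show "(\<Sum>p\<in>P. 1 * cmod (u p))\<^sup>2 \<le> (real (card P))\<^sup>2" by (simp add: power2_eq_square)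
  qed simp
  finally show ?thesis .
qed

text \<open>The large sieve at the single point 0, where the sum equals its number of terms.\<close>

lemma brun_titchmarsh:
  fixes N :: real
  assumes N: "N \<ge> 10 ^ 6" and H: "N \<le> real H" "real H \<le> 2 * N"
    and P: "P \<subseteq> {m<..m + H}" "\<forall>p\<in>P. prime p \<and> sqrt N < real p"
  shows "real (card P) \<le> 360 * exp (4 * pi + 2) * (N / ln N)"
proof -
  have H0: "H > 0" using H N by (intro Nat.gr0I) auto
  have lnN: "ln N > 0" using N by simp
  define c where "c = real (card P)"
  have "(\<Sum>k\<in>{0}. (cmod (exp_sum P (\<lambda>_. 1) (real k / real H)))\<^sup>2)
      \<le> 360 * exp (4 * pi + 2) * (N / ln N) * (\<Sum>p\<in>P. (cmod 1)\<^sup>2) * ln (2 * real (card {0::nat}))"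
    by (rule prime_large_sieve[OF N H P]) (use H0 in auto)
  then have "c\<^sup>2 \<le> 360 * exp (4 * pi + 2) * (N / ln N) * c * ln 2"
    by (simp add: exp_sum_def e_char_def c_def)
  also have "\<dots> \<le> 360 * exp (4 * pi + 2) * (N / ln N) * c * 1"
    using N lnN ln_2_less_1 by (intro mult_left_mono) (auto simp: c_def)
  finally have main: "c * c \<le> 360 * exp (4 * pi + 2) * (N / ln N) * c" by (simp add: power2_eq_square)
  show ?thesis
  proof (cases "c = 0")
    case True
    then show ?thesis using N lnN by (simp add: c_def)
  next
    case False
    then have "c > 0" by (simp add: c_def)
    with main have "c \<le> 360 * exp (4 * pi + 2) * (N / ln N)" by (rule mult_right_le_imp_le)
    then show ?thesis by (simp add: c_def)
  qed
qed

text \<open>Here \<open>W\<close> is, up to a constant, the square of the factor in the theorem, and \<open>W \<ge> 1\<close> by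
\<open>brun_titchmarsh\<close>. The factor
\<open>min (ln N) (1/t)\<close> appears as \<open>\<Phi>\<close> on the side of \<open>T\<close>. On the side of \<open>S\<close> there are three ranges:
if \<open>t\<close> is at most \<open>1 / ln (z + 1)\<close>, the trivial bound for \<open>\<bar>S\<bar> powr t\<close> and Parseval; for larger \<open>t \<le> 2\<close>, the
moment bound from the large sieve, matched with \<open>\<Phi>\<close> at the cutoff \<open>exp (1/t)\<close>; for \<open>t > 2\<close>, the
fourth moment and the trivial bound for the remaining power.\<close>

lemma hardy_littlewood_integral:
  fixes N l :: real and u :: "nat \<Rightarrow> complex"
  assumes N: "N \<ge> 10 ^ 6" and H: "N \<le> real H" "real H \<le> 2 * N"
    and P: "P \<subseteq> {m<..m + H}" "\<forall>p\<in>P. prime p \<and> sqrt N < real p" "P \<noteq> {}"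
    and U: "(\<Sum>p\<in>P. (cmod (u p))\<^sup>2) \<le> real (card P)" and l: "l \<ge> 2"
  defines "W \<equiv> 360 * exp (4 * pi + 2) * (N / ln N) / real (card P)"
  shows "integral {0..1} (\<lambda>\<alpha>. cmod (exp_sum P u \<alpha>) powr l)
    \<le> 576 * exp 1 * 2 powr l * W powr (l / 2) *
        integral {0..1} (\<lambda>\<alpha>. cmod (exp_sum P (\<lambda>_. 1) \<alpha>) powr l)"
proof -
  define R where "R = real (card P)"
  define t where "t = l - 2"
  define IS where "IS = integral {0..1} (\<lambda>\<alpha>. cmod (exp_sum P u \<alpha>) powr l)"
  define IT where "IT = integral {0..1} (\<lambda>\<alpha>. cmod (exp_sum P (\<lambda>_. 1) \<alpha>) powr l)"
  obtain z :: nat where z: "z > 0" "2 * real z ^ 4 \<le> N" "real z < sqrt N" "ln N / 5 \<le> ln (real z + 1)"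
    using sieve_level_exists[OF N] by blast
  define \<Phi> where "\<Phi> = (\<Sum>q\<in>sieve_moduli z {}. real (totient q) powr (- 1 - t))"
  have lt: "l = 2 + t" "t \<ge> 0" using l by (simp_all add: t_def)
  have finP: "finite P" using P(1) by (rule finite_subset) auto
  have R: "R \<ge> 1" using P(3) finP by (simp add: R_def Suc_le_eq card_gt_0_iff)
  have N0: "N > 0" and lnN: "ln N > 0" using N by simp_all
  have H0: "real H > 0" "H > 0" using H N0 by simp_all
  have W: "W \<ge> 1"
    unfolding W_def R_def[symmetric] using brun_titchmarsh[OF N H P(1,2)] R
    by (subst le_divide_eq_1_pos) (auto simp: R_def)
  have D: "360 * exp (4 * pi + 2) * (N / ln N) * R = W * R\<^sup>2"
    using R by (simp add: W_def R_def power2_eq_square)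
  have Dp: "(W * R\<^sup>2) powr (1 + s / 2) = W powr (1 + s / 2) * R powr (2 + s)" if "s \<ge> 0" for s
  proof -
    have "(R\<^sup>2) powr (1 + s / 2) = R powr (2 + s)"
      using R by (simp add: powr_powr distrib_left flip: powr_numeral)
    then show ?thesis using W R by (simp add: powr_mult)
  qed
  have half: "(R / 2) powr l = R powr l / 2 powr l" using R by (simp add: powr_divide)
  have low: "\<Phi> / (6 * real H) * (R powr l / 2 powr l) \<le> IT"
  proof -
    have "real (2 * z ^ 4) \<le> real H" using z(2) H by simp
    then have zH: "2 * z ^ 4 \<le> H" by (simp only: of_nat_le_iff)
    have cop: "\<forall>p\<in>P. \<forall>q\<in>sieve_moduli z {}. coprime p q"
      using P(2) z(3) by (auto intro!: coprime_sieve_moduli)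
    have "(\<Sum>q\<in>sieve_moduli z {}. real (totient q) powr (1 - l)) / (6 * real H) * (real (card P) / 2) powr l \<le> IT"
      unfolding IT_def using l by (intro integral_exp_sum_powr_ge[OF P(1) cop H0(2) zH]) auto
    then show ?thesis by (simp add: \<Phi>_def lt(1) R_def[symmetric] half[unfolded lt(1)])
  qed
  have \<Phi>low: "ln (real Y + 1) / (2 * exp 1) \<le> \<Phi>" if "real Y powr t \<le> exp 1" "Y \<le> z" for Y
    unfolding \<Phi>_def by (rule sum_totient_powr_ge[OF lt(2) that])
  have IT0: "IT \<ge> 0" unfolding IT_def using l
    by (intro integral_nonneg integrable_continuous_real continuous_on_norm_exp_sum_powr) auto
  \<comment> \<open>It suffices to bound the moment of \<open>S\<close> with some \<open>B\<close> in place of \<open>\<Phi>\<close>.\<close>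
  have conc: "IS \<le> 576 * exp 1 * 2 powr l * W powr (l / 2) * IT"
    if up: "IS \<le> B / real H * (W powr (l / 2) * R powr l)" and lo: "B \<le> 96 * exp 1 * \<Phi>" for B
  proof -
    have "IS \<le> 96 * exp 1 * \<Phi> / real H * (W powr (l / 2) * R powr l)"
      using H0 by (intro order_trans[OF up] mult_right_mono divide_right_mono lo) auto
    also have "\<dots> = 576 * exp 1 * 2 powr l * W powr (l / 2) * (\<Phi> / (6 * real H) * (R powr l / 2 powr l))"
      by (simp add: field_simps)
    also have "\<dots> \<le> 576 * exp 1 * 2 powr l * W powr (l / 2) * IT"
      by (intro mult_left_mono low) auto
    finally show ?thesis .
  qed
  have cont: "continuous_on UNIV (\<lambda>\<alpha>. cmod (exp_sum P u \<alpha>) powr l)"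
    using l by (intro continuous_on_norm_exp_sum_powr) auto
  have sup: "cmod (exp_sum P u x) \<le> R" for x
    unfolding R_def by (rule norm_exp_sum_le[OF finP U])
  have grid: "(\<Sum>k<H. cmod (exp_sum P u (\<alpha> + real k / real H)) powr (2 + s))
       \<le> 48 * (W powr (1 + s / 2) * R powr (2 + s)) / s" if "0 < s" "s \<le> 2" for \<alpha> s
    using grid_moment_exp_sum_le[OF N H P(1,2) U _ that, of \<alpha>] R that
    unfolding R_def[symmetric] D by (simp add: Dp)
  have "IS \<le> 576 * exp 1 * 2 powr l * W powr (l / 2) * IT"
  proof (cases "t * ln (real z + 1) \<le> 1")
    case True
    have inj: "inj_on (\<lambda>p. p mod H) P" by (rule inj_on_mod_window[OF P(1)])
    have zt: "real z powr t \<le> exp 1"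
    proof -
      have "real z powr t \<le> (real z + 1) powr t" using lt by (intro powr_mono2) auto
      also have "\<dots> = exp (t * ln (real z + 1))" by (simp add: powr_def)
      also have "\<dots> \<le> exp 1" using True by simp
      finally show ?thesis .
    qed
    have "ln N / (10 * exp 1) \<le> \<Phi>"
      using order_trans[OF divide_right_mono[OF z(4)] \<Phi>low[OF zt order_refl]] by simp
    then have "ln N \<le> 10 * exp 1 * \<Phi>" by (simp add: field_simps)
    moreover have "0 \<le> \<Phi>" unfolding \<Phi>_def by (intro sum_nonneg) auto
    then have "10 * exp 1 * \<Phi> \<le> 96 * exp 1 * \<Phi>" by (intro mult_right_mono) auto
    ultimately have lo: "ln N \<le> 96 * exp 1 * \<Phi>" by (rule order_trans)
    have g: "(\<Sum>k<H. cmod (exp_sum P u (\<alpha> + real k / real H)) powr l) \<le> real H * R powr (l - 1)" for \<alpha>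
    proof -
      define v where "v p = u p * e_char (real p * \<alpha>)" for p
      have shift: "exp_sum P u (\<alpha> + x) = exp_sum P v x" for x
        using exp_sum_shift[of P u x \<alpha>] by (simp add: v_def[abs_def] add.commute)
      have "(\<Sum>k<H. cmod (exp_sum P u (\<alpha> + real k / real H)) powr l)
          \<le> (\<Sum>k<H. R powr t * (cmod (exp_sum P u (\<alpha> + real k / real H)))\<^sup>2)"
      proof (rule sum_mono)
        fix k
        let ?y = "cmod (exp_sum P u (\<alpha> + real k / real H))"
        have "?y powr l = ?y powr t * ?y\<^sup>2"
          unfolding lt(1) by (cases "?y = 0") (simp_all add: powr_add)
        also have "\<dots> \<le> R powr t * ?y\<^sup>2" using lt sup by (intro mult_right_mono powr_mono2) auto
        finally show "?y powr l \<le> R powr t * ?y\<^sup>2" .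
      qed
      also have "\<dots> = R powr t * (\<Sum>k<H. (cmod (exp_sum P v (real k / real H)))\<^sup>2)"
        by (simp add: sum_distrib_left shift)
      also have "\<dots> = R powr t * (real H * (\<Sum>p\<in>P. (cmod (u p))\<^sup>2))"
        unfolding parseval_grid[OF H0(2) finP inj] by (simp add: v_def norm_mult)
      also have "\<dots> \<le> R powr t * (real H * R)"
        using U by (intro mult_left_mono) (auto simp: R_def)
      also have "\<dots> = real H * R powr (l - 1)" using R by (simp add: lt(1) powr_add mult_ac)
      finally show ?thesis .
    qed
    have "IS \<le> real H * R powr (l - 1) / real H"
      unfolding IS_def by (rule integral_le_of_grid_sums[OF H0(2) cont g])
    also have "\<dots> = R powr l / R" using H0 R by (simp add: powr_diff)
    also have "\<dots> \<le> ln N / real H * (W powr (l / 2) * R powr l)"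
    proof -
      have "W powr 1 \<le> W powr (l / 2)" using W l by (intro powr_mono) auto
      then have WW: "W \<le> W powr (l / 2)" using W by simp
      have "(360 * exp (4 * pi + 2)) * N = W * R * ln N"
        using R lnN by (simp add: W_def R_def[symmetric])
      moreover have "2 * N \<le> (360 * exp (4 * pi + 2)) * N"
      proof (rule mult_right_mono)
        have "(1::real) \<le> exp (4 * pi + 2)" by simp
        then show "2 \<le> 360 * exp (4 * pi + 2)" by linarith
      qed (use N0 in simp)
      ultimately have "real H \<le> W * R * ln N" using H by linarith
      also have "\<dots> \<le> W powr (l / 2) * R * ln N"
        using WW R lnN by (intro mult_right_mono) auto
      finally have "1 / R \<le> ln N / real H * W powr (l / 2)"
        using R H0 by (simp add: field_simps)
      then have "1 / R * R powr l \<le> ln N / real H * W powr (l / 2) * R powr l"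
        by (rule mult_right_mono) simp
      then show ?thesis by simp
    qed
    finally show ?thesis by (rule conc) (rule lo)
  next
    case False
    then have t0: "t > 0" using lt by (cases "t = 0") auto
    show ?thesis
    proof (cases "t \<le> 2")
      case True
      define Y where "Y = nat \<lfloor>exp (1 / t)\<rfloor>"
      have "exp (1 / t) \<ge> 0" by simp
      then have Y: "real Y \<le> exp (1 / t)" "exp (1 / t) < real Y + 1" unfolding Y_def by linarith+
      have "1 / t < ln (real z + 1)" using False t0 by (simp add: field_simps)
      then have "exp (1 / t) < exp (ln (real z + 1))" by (simp only: exp_less_cancel_iff)
      then have "exp (1 / t) < real z + 1" by simp
      then have "Y \<le> z" using Y by linarith
      moreover have "real Y powr t \<le> exp 1"
      proof -
        have "real Y powr t \<le> exp (1 / t) powr t" using Y t0 by (intro powr_mono2) auto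
        also have "\<dots> = exp 1" using t0 by (simp add: powr_def)
        finally show ?thesis .
      qed
      ultimately have "ln (real Y + 1) / (2 * exp 1) \<le> \<Phi>" by (intro \<Phi>low)
      moreover have "1 / t \<le> ln (real Y + 1)" using Y by (simp add: ln_ge_iff)
      ultimately have "48 / t \<le> 96 * exp 1 * \<Phi>" by (simp add: field_simps)
      moreover have "IS \<le> 48 / t / real H * (W powr (l / 2) * R powr l)"
      proof -
        have "IS \<le> 48 * (W powr (1 + t / 2) * R powr (2 + t)) / t / real H"
          unfolding IS_def by (rule integral_le_of_grid_sums[OF H0(2) cont]) (use grid[OF t0 True] lt in auto)
        moreover have "1 + t / 2 = l / 2" by (simp add: lt(1) add_divide_distrib)
        ultimately show ?thesis by (simp add: lt(1))
      qed
      ultimately show ?thesis by (intro conc)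
    next
      case False
      have "ln (real 1 + 1) / (2 * exp 1) \<le> \<Phi>" using z(1) by (intro \<Phi>low) auto
      moreover have "ln (2::real) \<ge> 1/2" using ln2_ge_two_thirds by simp
      ultimately have "24 \<le> 96 * exp 1 * \<Phi>" by (simp add: field_simps)
      moreover have "IS \<le> 24 / real H * (W powr (l / 2) * R powr l)"
      proof -
        have "IS \<le> 24 * (W powr 2 * R powr l) / real H"
          unfolding IS_def
        proof (rule integral_le_of_grid_sums[OF H0(2) cont])
          fix \<alpha>
          have "(\<Sum>k<H. cmod (exp_sum P u (\<alpha> + real k / real H)) powr l)
             \<le> (\<Sum>k<H. R powr (t - 2) * cmod (exp_sum P u (\<alpha> + real k / real H)) powr (2 + 2))"
          proof (rule sum_mono)
            fix k
            let ?y = "cmod (exp_sum P u (\<alpha> + real k / real H))"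
            have "?y powr l = ?y powr (t - 2) * ?y powr (2 + 2)"
              unfolding lt(1) by (simp only: powr_add[symmetric]) simp
            also have "\<dots> \<le> R powr (t - 2) * ?y powr (2 + 2)"
              using False sup by (intro mult_right_mono powr_mono2) auto
            finally show "?y powr l \<le> R powr (t - 2) * ?y powr (2 + 2)" .
          qed
          also have "\<dots> = R powr (t - 2) * (\<Sum>k<H. cmod (exp_sum P u (\<alpha> + real k / real H)) powr (2 + 2))"
            by (simp only: sum_distrib_left)
          also have "\<dots> \<le> R powr (t - 2) * (48 * (W powr (1 + 2 / 2) * R powr (2 + 2)) / 2)"
            by (intro mult_left_mono grid) auto
          also have "\<dots> = 24 * (W powr 2 * (R powr (t - 2) * R powr (2 + 2)))" by simp
          also have "R powr (t - 2) * R powr (2 + 2) = R powr l"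
            unfolding lt(1) by (simp only: powr_add[symmetric]) simp
          finally show "(\<Sum>k<H. cmod (exp_sum P u (\<alpha> + real k / real H)) powr l) \<le> 24 * (W powr 2 * R powr l)" .
        qed
        also have "\<dots> \<le> 24 * (W powr (l / 2) * R powr l) / real H"
          using W False lt by (intro divide_right_mono mult_left_mono mult_right_mono powr_mono) auto
        finally show ?thesis by simp
      qed
      ultimately show ?thesis by (intro conc)
    qed
  qed
  then show ?thesis unfolding IS_def IT_def .
qed

theorem theorem10p4:
  shows "\<exists>C::real. C > 0 \<and>
    (\<forall>(N::real) (M::real) (l::real) (R::real) (u :: nat \<Rightarrow> complex).
      N \<ge> 10 ^ 6 \<longrightarrow> M \<ge> sqrt N \<longrightarrow> l \<ge> 2 \<longrightarrow>
      R = (\<Sum>p\<in>primes_between (M + 1) (M + N). 1) \<longrightarrow>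
      (\<Sum>p\<in>primes_between (M + 1) (M + N). (cmod (u p))\<^sup>2) \<le> R \<longrightarrow>
      (integral {0..1} (\<lambda>\<alpha>. cmod (\<Sum>p\<in>primes_between (M + 1) (M + N).
          u p * e_char (real p * \<alpha>)) powr l)) powr (1 / l)
      \<le> C * sqrt ((N / ln N) / (1 + R)) *
        (integral {0..1} (\<lambda>\<alpha>. cmod (\<Sum>p\<in>primes_between (M + 1) (M + N).
          e_char (real p * \<alpha>)) powr l)) powr (1 / l))"
proof -
  define K where "K = 576 * exp (1::real)"
  define c where "c = 360 * exp (4 * pi + 2)"
  have K: "K \<ge> 1"
  proof -
    have "(1::real) \<le> exp 1" using exp_ge_add_one_self[of "1::real"] by simp
    then show ?thesis unfolding K_def by linarith
  qed
  have c: "c > 0" by (simp add: c_def)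
  have main: "(integral {0..1} (\<lambda>\<alpha>. cmod (exp_sum P u \<alpha>) powr l)) powr (1 / l)
      \<le> 2 * K * sqrt (2 * c) * sqrt ((N / ln N) / (1 + R)) *
        (integral {0..1} (\<lambda>\<alpha>. cmod (exp_sum P (\<lambda>_. 1) \<alpha>) powr l)) powr (1 / l)"
    if N: "N \<ge> 10 ^ 6" and M: "M \<ge> sqrt N" and l: "l \<ge> 2" and Pdef: "P = primes_between (M + 1) (M + N)"
      and R: "R = (\<Sum>p\<in>P. 1)" and U: "(\<Sum>p\<in>P. (cmod (u p))\<^sup>2) \<le> R"
    for N M l R :: real and u :: "nat \<Rightarrow> complex" and P :: "nat set"
  proof (cases "P = {}")
    case True
    then show ?thesis using l by (simp add: exp_sum_def)
  next
    case False
    \<comment> \<open>The window is \<open>{m<..m + H}\<close>, so distinct primes of the interval stay distinct modulo \<open>H\<close>.\<close>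
    define H where "H = nat \<lceil>N\<rceil>"
    define m where "m = nat \<lceil>M\<rceil>"
    have N0: "N > 0" "ln N > 0" using N by simp_all
    have M0: "M > 0" using M N0 by (meson less_le_trans real_sqrt_gt_zero)
    have "N \<ge> 1" using N by simp
    then have H: "N \<le> real H" "real H \<le> 2 * N" unfolding H_def by linarith+
    have mM: "M \<le> real m" "real m < M + 1" unfolding m_def using M0 by linarith+
    have P1: "P \<subseteq> {m<..m + H}"
    proof
      fix p assume "p \<in> P"
      then have "M + 1 \<le> real p" "real p \<le> M + N" by (auto simp: Pdef primes_between_def)
      then have "real m < real p" "real p \<le> real m + real H" using mM H by linarith+
      then show "p \<in> {m<..m + H}" by auto
    qed
    have P2: "\<forall>p\<in>P. prime p \<and> sqrt N < real p"
      using M by (auto simp: Pdef primes_between_def)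
    have Rc: "R = real (card P)" using R by simp
    have "finite P" using P1 by (rule finite_subset) auto
    then have R1: "R \<ge> 1" using False by (simp add: Rc Suc_le_eq card_gt_0_iff)
    define W where "W = c * (N / ln N) / R"
    define IS where "IS = integral {0..1} (\<lambda>\<alpha>. cmod (exp_sum P u \<alpha>) powr l)"
    define IT where "IT = integral {0..1} (\<lambda>\<alpha>. cmod (exp_sum P (\<lambda>_. 1) \<alpha>) powr l)"
    have pos: "IS \<ge> 0" "IT \<ge> 0" unfolding IS_def IT_def using l
      by (intro integral_nonneg integrable_continuous_real continuous_on_norm_exp_sum_powr; simp)+
    have W0: "W \<ge> 0" using c N0 R1 by (simp add: W_def)
    have "IS \<le> K * 2 powr l * W powr (l / 2) * IT"
      using hardy_littlewood_integral[OF N H P1 P2 False, of u l] U l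
      unfolding IS_def IT_def K_def W_def c_def Rc by simp
    then have "IS powr (1 / l) \<le> (K * 2 powr l * W powr (l / 2) * IT) powr (1 / l)"
      using pos l by (intro powr_mono2) auto
    also have "\<dots> = K powr (1 / l) * 2 * W powr (1 / 2) * IT powr (1 / l)"
      using l K W0 pos by (simp add: powr_mult powr_powr)
    also have "\<dots> \<le> K * 2 * W powr (1 / 2) * IT powr (1 / l)"
    proof -
      have "K powr (1 / l) \<le> K powr 1" using K l by (intro powr_mono) auto
      then show ?thesis using K by (intro mult_right_mono) auto
    qed
    also have "W powr (1 / 2) = sqrt W" using W0 by (simp add: powr_half_sqrt)
    also have "K * 2 * sqrt W * IT powr (1 / l) \<le> K * 2 * sqrt (2 * c * ((N / ln N) / (1 + R))) * IT powr (1 / l)"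
    proof -
      have "1 / R \<le> 2 / (1 + R)" using R1 by (simp add: field_simps)
      then have "c * (N / ln N) * (1 / R) \<le> c * (N / ln N) * (2 / (1 + R))"
        using c N0 by (intro mult_left_mono) auto
      then have "W \<le> 2 * c * ((N / ln N) / (1 + R))" by (simp add: W_def mult_ac)
      then show ?thesis using K by (intro mult_right_mono mult_left_mono real_sqrt_le_mono) auto
    qed
    also have "\<dots> = 2 * K * sqrt (2 * c) * sqrt ((N / ln N) / (1 + R)) * IT powr (1 / l)"
      by (simp only: real_sqrt_mult mult_ac)
    finally show ?thesis unfolding IS_def IT_def .
  qed
  show ?thesis
  proof (intro exI[of _ "2 * K * sqrt (2 * c)"] conjI allI impI)
    show "0 < 2 * K * sqrt (2 * c)" using K c by simp
  next
    fix N M l R :: real and u :: "nat \<Rightarrow> complex"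
    assume "10 ^ 6 \<le> N" "sqrt N \<le> M" "2 \<le> l" "R = (\<Sum>p\<in>primes_between (M + 1) (M + N). 1)"
      "(\<Sum>p\<in>primes_between (M + 1) (M + N). (cmod (u p))\<^sup>2) \<le> R"
    then show "(integral {0..1} (\<lambda>\<alpha>. cmod (\<Sum>p\<in>primes_between (M + 1) (M + N).
          u p * e_char (real p * \<alpha>)) powr l)) powr (1 / l)
      \<le> 2 * K * sqrt (2 * c) * sqrt ((N / ln N) / (1 + R)) *
        (integral {0..1} (\<lambda>\<alpha>. cmod (\<Sum>p\<in>primes_between (M + 1) (M + N).
          e_char (real p * \<alpha>)) powr l)) powr (1 / l)"
      using main[of N M l "primes_between (M + 1) (M + N)" R u] by (simp add: exp_sum_def)
  qed
qed

end
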